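(* Let $D$ be a strongly connected balanced bipartite digraph of order $2a\geq 8$ with partite sets $X$ and $Y$. If $D$ is not a directed cycle and $\max\{d(x),d(y)\}\geq 2a-1$ for every dominating pair of vertices $\{x,y\}$ of $D$, then either $D$ contains cycles of all even lengths less than or equal to $2a$ (that is, a cycle of length $2k$ for every integer $k$ with $1\leq k\leq a$) or $D$ is isomorphic to the digraph $D(8)$.
   Context: All digraphs are finite, without loops and without multiple arcs (but both arcs $xy$ and $yx$ may be present). A digraph $D$ is bipartite if its vertex set has a partition into two partite sets $X,Y$ such that every arc has its end-vertices in different partite sets; it is balanced if $|X|=|Y|$. The order of $D$ is its number of vertices. $D$ is strongly connected if for every pair of distinct vertices $x,y$ there are a directed path from $x$ to $y$ and a directed path from $y$ to $x$. Write $x\rightarrow z$ if $xz$ is an arc of $D$, and $x\leftrightarrow z$ if both $xz$ and $zx$ are arcs (a 2-cycle). A pair $\{x,y\}$ of distinct vertices is a dominating pair if there is a vertex $z$ with $x\rightarrow z$ and $y\rightarrow z$. The degree of $x$ is $d(x)=d^+(x)+d^-(x)$, the sum of the out-degree and the in-degree of $x$ in $D$. A cycle means a directed cycle $x_1x_2\cdots x_mx_1$ with distinct vertices $x_1,\dots,x_m$, $m\geq 2$; its length is its number $m$ of arcs. In particular a pair of opposite arcs forms a cycle of length $2$. "$D$ is a directed cycle" means that $D$ consists exactly of the vertices and arcs of a single directed cycle (of length $2a$). Definition of $D(8)$: it is the bipartite digraph with partite sets $\{x_0,x_1,x_2,x_3\}$ and $\{y_0,y_1,y_2,y_3\}$ containing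 the arcs $y_0x_1$, $y_1x_0$, $x_2y_3$, $x_3y_2$ and all the arcs of the 2-cycles $x_i\leftrightarrow y_i$ for $i\in\{0,1,2,3\}$, $y_0\leftrightarrow x_2$, $y_0\leftrightarrow x_3$, $y_1\leftrightarrow x_2$, $y_1\leftrightarrow x_3$, and containing no other arcs. *)

theory Defs
  imports "Graph_Theory.Graph_Theory"
begin

definition bipartition :: "('a,'b) pre_digraph \<Rightarrow> 'a set \<Rightarrow> 'a set \<Rightarrow> bool" where
  "bipartition D X Y \<longleftrightarrow>
     X \<union> Y = verts D \<and> X \<inter> Y = {} \<and>
     (\<forall>e\<in>arcs D. (tail D e \<in> X \<and> head D e \<in> Y) \<or> (tail D e \<in> Y \<and> head D e \<in> X))"

definition balanced_bipartition :: "('a,'b) pre_digraph \<Rightarrow> 'a set \<Rightarrow> 'a set \<Rightarrow> bool" where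
  "balanced_bipartition D X Y \<longleftrightarrow> bipartition D X Y \<and> card X = card Y"

definition degree :: "('a,'b) pre_digraph \<Rightarrow> 'a \<Rightarrow> nat" where
  "degree D x = out_degree D x + in_degree D x"

definition dominating_pair :: "('a,'b) pre_digraph \<Rightarrow> 'a \<Rightarrow> 'a \<Rightarrow> bool" where
  "dominating_pair D x y \<longleftrightarrow>
     x \<in> verts D \<and> y \<in> verts D \<and> x \<noteq> y \<and>
     (\<exists>z\<in>verts D. x \<rightarrow>\<^bsub>D\<^esub> z \<and> y \<rightarrow>\<^bsub>D\<^esub> z)"

text \<open>Cycles are given by their lists of arcs, so the length of the list is the length of the
  cycle. The library's notion admits a loop as a cycle of length 1; this is void in a
  \<^locale>\<open>digraph\<close>, which has no loops.\<close>

definition has_cycle_of_length :: "('a,'b) pre_digraph \<Rightarrow> nat \<Rightarrow> bool" where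
  "has_cycle_of_length D m \<longleftrightarrow> (\<exists>p. pre_digraph.cycle D p \<and> length p = m)"

definition is_directed_cycle :: "('a,'b) pre_digraph \<Rightarrow> bool" where
  "is_directed_cycle D \<longleftrightarrow>
     (\<exists>u p. pre_digraph.cycle D p \<and> pre_digraph.awalk D u p u \<and>
            set (pre_digraph.awalk_verts D u p) = verts D \<and> set p = arcs D)"

datatype d8_vertex = Xv nat | Yv nat

text \<open>One orientation of each 2-cycle of \<open>D(8)\<close>.\<close>

definition D8_two_cycles :: "(d8_vertex \<times> d8_vertex) set" where
  "D8_two_cycles =
     {(Xv i, Yv i) |i. i < 4} \<union>
     {(Yv 0, Xv 2), (Yv 0, Xv 3), (Yv 1, Xv 2), (Yv 1, Xv 3)}"

definition D8 :: "(d8_vertex, d8_vertex \<times> d8_vertex) pre_digraph" where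
  "D8 = \<lparr> verts = Xv ` {..<4} \<union> Yv ` {..<4},
          arcs = {(Yv 0, Xv 1), (Yv 1, Xv 0), (Xv 2, Yv 3), (Xv 3, Yv 2)} \<union>
                 D8_two_cycles \<union> D8_two_cycles\<inverse>,
          tail = fst, head = snd \<rparr>"

lemma digraph_D8: "digraph D8"
proof
  have "{(Xv i, Yv i) |i. i < (4::nat)} = (\<lambda>i. (Xv i, Yv i)) ` {..<4}" by auto
  then show "finite (arcs D8)" by (simp add: D8_def D8_two_cycles_def)
qed (auto simp: D8_def D8_two_cycles_def arc_to_ends_def)

lemma balanced_bipartition_D8:
  "balanced_bipartition D8 (Xv ` {..<4}) (Yv ` {..<4})"
  by (auto simp: balanced_bipartition_def bipartition_def D8_def D8_two_cycles_def
      card_image inj_on_def)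

end

theory Submission
  imports Defs
begin

text \<open>Call a vertex big if its degree is at least \<open>2 * a - 1\<close> and small otherwise. The hypothesis says
  that no vertex has two small in-neighbours. If all vertices are small, strong connectivity forces
  \<open>D\<close> to be a directed cycle. Otherwise a big vertex, which misses at most one arc, bounds the
  number of small vertices in the opposite partite set by two, and hence there are at most two
  small vertices on either side. A big vertex of each partite set can be inserted together into any
  cycle of length at least 4 avoiding them, so it suffices to exhibit three cycles of length between
  4 and 10: one on big vertices, one missing at most one small vertex of each side and one
  containing all small vertices. Only the last of these can fail to exist, namely when \<open>a = 4\<close>,
  there are two small vertices on either side and no arcs between small vertices; this is \<open>D(8)\<close>.\<close>

text \<open>Vertex lists instead of the arc lists of the library: the combinatorial argument needs
  only an adjacency relation. Appending the head accounts for the closing arc; the passage to arc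
  lists is \<open>has_cycle_of_length_if_is_cycle\<close>.\<close>

definition is_cycle :: "('a \<Rightarrow> 'a \<Rightarrow> bool) \<Rightarrow> 'a list \<Rightarrow> bool" where
  "is_cycle E vs \<longleftrightarrow> vs \<noteq> [] \<and> distinct vs \<and> successively E (vs @ [hd vs])"

text \<open>Arcs of \<open>D8\<close> are the pairs of their ends, so the equivalence makes
  \<open>f\<close> an isomorphism of adjacency relations onto \<open>V\<close>.\<close>

definition D8_embedding :: "('a \<Rightarrow> 'a \<Rightarrow> bool) \<Rightarrow> 'a set \<Rightarrow> bool" where
  "D8_embedding E V \<longleftrightarrow> (\<exists>f. inj_on f (verts D8) \<and> f ` verts D8 = V \<and>
     (\<forall>u\<in>verts D8. \<forall>v\<in>verts D8. E (f u) (f v) \<longleftrightarrow> (u, v) \<in> arcs D8))"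

section \<open>Selection of distinct elements\<close>

lemma obtain_two_distinct:
  assumes "2 \<le> card S"
  obtains x y where "x \<in> S" "y \<in> S" "x \<noteq> y"
proof -
  obtain T where "T \<subseteq> S" "card T = 2" using obtain_subset_with_card_n[OF assms] by blast
  then show thesis using that by (auto simp: card_2_iff)
qed

lemma obtain_three_distinct:
  assumes "3 \<le> card S"
  obtains x y z where "x \<in> S" "y \<in> S" "z \<in> S" "distinct [x, y, z]"
proof -
  obtain T where "T \<subseteq> S" "card T = 3" using obtain_subset_with_card_n[OF assms] by blast
  then show thesis using that by (auto simp: card_3_iff)
qed

text \<open>If the two given witnesses coincide, the common one satisfies both predicates, and any
  second element of \<open>S\<close> takes over one of the two roles.\<close>

lemma distinct_representatives:
  assumes "2 \<le> card S" "\<And>x. x \<in> S \<Longrightarrow> P x \<or> Q x" "x \<in> S" "P x" "y \<in> S" "Q y"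
  obtains u v where "u \<in> S" "v \<in> S" "u \<noteq> v" "P u" "Q v"
  using assms by (metis obtain_two_distinct)

text \<open>The set \<open>B\<close> plays the role of the vertices of degree at least \<open>2 * a - 1\<close>, so each of
  its elements misses at most one of its \<open>2 * a\<close> potential arcs. The assumption \<open>cut\<close> is strong
  connectivity.\<close>

locale near_complete_bipartite =
  fixes E :: "'a \<Rightarrow> 'a \<Rightarrow> bool" and X Y B :: "'a set" and a :: nat
  assumes finite_X: "finite X" and finite_Y: "finite Y" and disjoint: "X \<inter> Y = {}"
    and card_X: "card X = a" and card_Y: "card Y = a" and a_ge_4: "4 \<le> a"
    and arc: "E u v \<Longrightarrow> u \<in> X \<and> v \<in> Y \<or> u \<in> Y \<and> v \<in> X"
    and big_out: "\<lbrakk>v \<in> B; v \<in> X \<and> {y, y'} \<subseteq> Y \<or> v \<in> Y \<and> {y, y'} \<subseteq> X; \<not> E v y; \<not> E v y'\<rbrakk> \<Longrightarrow> y = y'"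
    and big_in: "\<lbrakk>v \<in> B; v \<in> X \<and> {y, y'} \<subseteq> Y \<or> v \<in> Y \<and> {y, y'} \<subseteq> X; \<not> E y v; \<not> E y' v\<rbrakk> \<Longrightarrow> y = y'"
    and big_out_in: "\<lbrakk>v \<in> B; v \<in> X \<and> {y, y'} \<subseteq> Y \<or> v \<in> Y \<and> {y, y'} \<subseteq> X; \<not> E v y\<rbrakk> \<Longrightarrow> E y' v"
    and small: "\<lbrakk>u \<in> X \<union> Y; v \<in> X \<union> Y; u \<notin> B; v \<notin> B; E u z; E v z\<rbrakk> \<Longrightarrow> u = v"
    and cut: "\<lbrakk>S \<subseteq> X \<union> Y; S \<noteq> {}; S \<noteq> X \<union> Y\<rbrakk> \<Longrightarrow> \<exists>u\<in>S. \<exists>v\<in>X \<union> Y - S. E u v"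
    and exists_big: "(X \<union> Y) \<inter> B \<noteq> {}"
begin

text \<open>All assumptions are symmetric in the partite sets, so facts about \<open>X\<close>
  transfer to \<open>Y\<close> through this one. Reversing the arcs is no symmetry, since
  \<open>small\<close> speaks of common out-neighbours only; arguments about in-neighbours therefore
  get their own proofs.\<close>

lemma swapped: "near_complete_bipartite E Y X B a"
proof
  show "\<And>u v. E u v \<Longrightarrow> u \<in> Y \<and> v \<in> X \<or> u \<in> X \<and> v \<in> Y" using arc by blast
  show "\<And>v y y'. \<lbrakk>v \<in> B; v \<in> Y \<and> {y, y'} \<subseteq> X \<or> v \<in> X \<and> {y, y'} \<subseteq> Y; \<not> E v y; \<not> E v y'\<rbrakk> \<Longrightarrow> y = y'"
    using big_out by blast
  show "\<And>v y y'. \<lbrakk>v \<in> B; v \<in> Y \<and> {y, y'} \<subseteq> X \<or> v \<in> X \<and> {y, y'} \<subseteq> Y; \<not> E y v; \<not> E y' v\<rbrakk> \<Longrightarrow> y = y'"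
    using big_in by blast
  show "\<And>v y y'. \<lbrakk>v \<in> B; v \<in> Y \<and> {y, y'} \<subseteq> X \<or> v \<in> X \<and> {y, y'} \<subseteq> Y; \<not> E v y\<rbrakk> \<Longrightarrow> E y' v"
    using big_out_in by blast
  show "\<And>u v z. \<lbrakk>u \<in> Y \<union> X; v \<in> Y \<union> X; u \<notin> B; v \<notin> B; E u z; E v z\<rbrakk> \<Longrightarrow> u = v"
    using small by blast
  show "\<And>S. \<lbrakk>S \<subseteq> Y \<union> X; S \<noteq> {}; S \<noteq> Y \<union> X\<rbrakk> \<Longrightarrow> \<exists>u\<in>S. \<exists>v\<in>Y \<union> X - S. E u v"
    using cut by (simp add: Un_commute)
qed (use finite_X finite_Y disjoint card_X card_Y a_ge_4 exists_big in auto)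

section \<open>Arcs at big vertices and neighbours of arbitrary vertices\<close>

lemma bigX:
  assumes "x \<in> X" "x \<in> B"
  shows "\<And>y y'. \<lbrakk>y \<in> Y; y' \<in> Y; \<not> E x y; \<not> E x y'\<rbrakk> \<Longrightarrow> y = y'"
    and "\<And>y y'. \<lbrakk>y \<in> Y; y' \<in> Y; \<not> E y x; \<not> E y' x\<rbrakk> \<Longrightarrow> y = y'"
    and "\<And>y y'. \<lbrakk>y \<in> Y; y' \<in> Y; \<not> E x y\<rbrakk> \<Longrightarrow> E y' x"
    and "\<And>y y'. \<lbrakk>y \<in> Y; y' \<in> Y; \<not> E y' x\<rbrakk> \<Longrightarrow> E x y"
  using big_out[of x] big_in[of x] big_out_in[of x] assms by blast+

lemmas bigY = near_complete_bipartite.bigX[OF swapped]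

lemma arcX: "x \<in> X \<Longrightarrow> E x v \<Longrightarrow> v \<in> Y" and arcX': "x \<in> X \<Longrightarrow> E v x \<Longrightarrow> v \<in> Y"
  using arc disjoint by blast+

lemmas arcY = near_complete_bipartite.arcX[OF swapped] and arcY' = near_complete_bipartite.arcX'[OF swapped]

lemma out_neighbour:
  assumes "u \<in> X \<union> Y"
  shows "\<exists>v. E u v"
proof -
  have "{u} \<noteq> X \<union> Y"
  proof
    assume "{u} = X \<union> Y"
    then have "X \<subseteq> {u}" by blast
    then have "card X \<le> 1" using card_mono[of "{u}" X] by simp
    then show False using card_X a_ge_4 by simp
  qed
  then show ?thesis using cut[of "{u}"] assms by auto
qed

lemma in_neighbour:
  assumes "u \<in> X \<union> Y"
  shows "\<exists>v. E v u"
proof -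
  have "X \<union> Y - {u} \<noteq> {}"
  proof
    assume "X \<union> Y - {u} = {}"
    then have "X \<subseteq> {u}" by auto
    then have "card X \<le> 1" using card_mono[of "{u}" X] by simp
    then show False using card_X a_ge_4 by simp
  qed
  then show ?thesis using cut[of "X \<union> Y - {u}"] assms by auto
qed

lemma out_neighbourX: "x \<in> X \<Longrightarrow> \<exists>y\<in>Y. E x y"
  and in_neighbourX: "x \<in> X \<Longrightarrow> \<exists>y\<in>Y. E y x"
  using out_neighbour in_neighbour arcX arcX' by (meson UnI1)+

lemmas out_neighbourY = near_complete_bipartite.out_neighbourX[OF swapped]
  and in_neighbourY = near_complete_bipartite.in_neighbourX[OF swapped]

subsection \<open>Extending cycles by big vertices\<close>

lemma is_cycle_subset:
  assumes "is_cycle E vs"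
  shows "set vs \<subseteq> X \<union> Y"
proof -
  have "set ws \<subseteq> X \<union> Y" if "successively E (ws @ [v])" for ws v
    using that
  proof (induction ws)
    case (Cons w ws)
    then show ?case using arc[of w "hd (ws @ [v])"] by (auto simp: successively_Cons)
  qed simp
  then show ?thesis using assms unfolding is_cycle_def by blast
qed

lemma is_cycle_balanced:
  assumes "is_cycle E vs"
  shows "2 * card (X \<inter> set vs) = length vs" "2 * card (Y \<inter> set vs) = length vs"
proof -
  define cnt where "cnt S ws = length (filter (\<lambda>v. v \<in> S) ws)" for S and ws :: "'a list"
  \<comment> \<open>Arcs alternate between the sides, so the two counts over \<open>ws\<close>
    differ by an amount fixed by the sides of the two ends of the walk. For a closed walk the
    correction terms cancel.\<close>
  have alt: "cnt X ws + of_bool (last (u # ws) \<in> Y) = cnt Y ws + of_bool (u \<in> Y)"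
    if "successively E (u # ws)" for u ws
    using that
  proof (induction ws arbitrary: u)
    case (Cons w ws)
    then have "E u w" by simp
    then show ?case using Cons.IH[of w] Cons.prems arc[of u w] disjoint
      by (auto simp: cnt_def)
  qed (simp add: cnt_def)
  obtain u ws where vs: "vs = u # ws" using assms by (cases vs) (auto simp: is_cycle_def)
  have "cnt X (ws @ [u]) = cnt Y (ws @ [u])"
    using alt[of u "ws @ [u]"] assms by (simp add: is_cycle_def vs)
  then have eq: "cnt X vs = cnt Y vs" by (simp add: cnt_def vs split: if_splits)
  have card: "card (S \<inter> set vs) = cnt S vs" for S
    using assms distinct_card[of "filter (\<lambda>v. v \<in> S) vs"]
    by (simp add: is_cycle_def cnt_def Int_def conj_commute)
  have "set vs = (X \<inter> set vs) \<union> (Y \<inter> set vs)" using is_cycle_subset[OF assms] by blast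
  then have "card (set vs) = card (X \<inter> set vs) + card (Y \<inter> set vs)"
    using card_Un_disjoint[of "X \<inter> set vs" "Y \<inter> set vs"] disjoint by auto
  then have "length vs = cnt X vs + cnt Y vs"
    using assms by (simp add: is_cycle_def distinct_card card)
  then show "2 * card (X \<inter> set vs) = length vs" "2 * card (Y \<inter> set vs) = length vs"
    using eq card by auto
qed

text \<open>If neither \<open>u1 \<rightarrow> x \<rightarrow> y \<rightarrow> v1\<close> nor \<open>u2 \<rightarrow> x \<rightarrow> y \<rightarrow> v2\<close> is possible, then \<open>x\<close> and \<open>y\<close> have used up
  the arcs they may miss in such a way that \<open>v1 \<rightarrow> y \<rightarrow> x \<rightarrow> u2\<close> is possible.\<close>

lemma insert_big_pair_from_Y:
  assumes cyc: "is_cycle E (u1 # v1 # u2 # v2 # r)" and "u1 \<in> Y"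
    and x: "x \<in> X" "x \<in> B" "x \<notin> set (u1 # v1 # u2 # v2 # r)"
    and y: "y \<in> Y" "y \<in> B" "y \<notin> set (u1 # v1 # u2 # v2 # r)"
  obtains ws where "is_cycle E ws" "set ws = {x, y} \<union> set (u1 # v1 # u2 # v2 # r)"
    "length ws = length (u1 # v1 # u2 # v2 # r) + 2"
proof -
  let ?vs = "u1 # v1 # u2 # v2 # r"
  have E: "E u1 v1" "E v1 u2" "E u2 v2" and dist: "distinct ?vs"
    and rest: "successively E (v2 # r @ [u1])"
    using cyc by (auto simp: is_cycle_def)
  have sides: "u2 \<in> Y" "v1 \<in> X" "v2 \<in> X" using E \<open>u1 \<in> Y\<close> arcX arcY by blast+
  have "x \<noteq> y" using x y disjoint by blast
  have "u1 \<noteq> u2" "v1 \<noteq> v2" "u1 \<noteq> y" "u2 \<noteq> y" "v1 \<noteq> x" using dist x(3) y(3) by auto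
  then have "E u1 x \<or> E u2 x" "E u1 x \<or> E y x" "E u2 x \<or> E y x" "E x u2 \<or> E x y" "E y v1 \<or> E y v2"
    "E v1 y \<or> E x y"
    using bigX(1,2)[OF x(1,2)] bigY(1,2)[OF y(1,2)] sides \<open>u1 \<in> Y\<close> x(1) y(1) by blast+
  moreover have "E x y \<or> E u1 x" "E x y \<or> E u2 x" "E x u2 \<or> E u1 x" "E x u2 \<or> E u2 x" "E x y \<or> E y x"
    using bigX(3)[OF x(1,2)] sides \<open>u1 \<in> Y\<close> y(1) by blast+
  moreover have "E v1 y \<or> E y v1" "E v1 y \<or> E y v2" "E x y \<or> E y v1" "E x y \<or> E y v2"
    using bigY(4)[OF y(1,2)] bigY(3)[OF y(1,2)] sides x(1) by blast+
  ultimately consider "E u1 x \<and> E x y \<and> E y v1" | "E u2 x \<and> E x y \<and> E y v2" | "E v1 y \<and> E y x \<and> E x u2"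
    by argo
  then show thesis
  proof cases
    case 1
    then have "is_cycle E (u1 # x # y # v1 # u2 # v2 # r)"
      using E rest dist x y \<open>x \<noteq> y\<close> by (auto simp: is_cycle_def)
    then show thesis by (rule that) auto
  next
    case 2
    then have "is_cycle E (u1 # v1 # u2 # x # y # v2 # r)"
      using E rest dist x y \<open>x \<noteq> y\<close> by (auto simp: is_cycle_def)
    then show thesis by (rule that) auto
  next
    case 3
    then have "is_cycle E (u1 # v1 # y # x # u2 # v2 # r)"
      using E rest dist x y \<open>x \<noteq> y\<close> by (auto simp: is_cycle_def)
    then show thesis by (rule that) auto
  qed
qed

text \<open>The list is not rotated: if it starts in \<open>X\<close>, the preceding lemma is
  applied with the partite sets exchanged.\<close>

lemma insert_big_pair:
  assumes cyc: "is_cycle E vs" and len: "4 \<le> length vs"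
    and x: "x \<in> X" "x \<in> B" "x \<notin> set vs" and y: "y \<in> Y" "y \<in> B" "y \<notin> set vs"
  obtains ws where "is_cycle E ws" "set ws = {x, y} \<union> set vs" "length ws = length vs + 2"
proof -
  obtain u1 v1 u2 v2 r where vs: "vs = u1 # v1 # u2 # v2 # r"
    using len by (auto simp: numeral_eq_Suc Suc_le_length_iff)
  have "u1 \<in> X \<or> u1 \<in> Y" using is_cycle_subset[OF cyc] by (auto simp: vs)
  then show thesis
  proof
    assume "u1 \<in> X"
    then obtain ws where "is_cycle E ws" "set ws = {y, x} \<union> set vs" "length ws = length vs + 2"
      using near_complete_bipartite.insert_big_pair_from_Y[OF swapped] cyc x y unfolding vs by blast
    then show thesis by (intro that[of ws]) auto
  next
    assume "u1 \<in> Y"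
    then show thesis using insert_big_pair_from_Y cyc x y that unfolding vs by blast
  qed
qed

lemma insert_big_pairs:
  assumes "is_cycle E vs" "4 \<le> length vs"
    and "n \<le> card (X \<inter> B - set vs)" "n \<le> card (Y \<inter> B - set vs)"
  shows "\<exists>ws. is_cycle E ws \<and> length ws = length vs + 2 * n"
  using assms
proof (induction n arbitrary: vs)
  case (Suc n)
  have "X \<inter> B - set vs \<noteq> {}" "Y \<inter> B - set vs \<noteq> {}" using Suc.prems(3,4) by (metis card.empty not_less_eq_eq le0)+
  then obtain x y where x: "x \<in> X" "x \<in> B" "x \<notin> set vs" and y: "y \<in> Y" "y \<in> B" "y \<notin> set vs"
    by blast
  obtain ws where ws: "is_cycle E ws" "set ws = {x, y} \<union> set vs" "length ws = length vs + 2"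
    using insert_big_pair[OF Suc.prems(1,2) x y] by metis
  have "X \<inter> B - set ws = (X \<inter> B - set vs) - {x}" "Y \<inter> B - set ws = (Y \<inter> B - set vs) - {y}"
    using ws(2) x y disjoint by auto
  then have "card (X \<inter> B - set ws) = card (X \<inter> B - set vs) - 1"
    "card (Y \<inter> B - set ws) = card (Y \<inter> B - set vs) - 1"
    using x y by (simp_all add: card_Diff_singleton)
  then have "\<exists>us. is_cycle E us \<and> length us = length ws + 2 * n"
    using Suc.IH[of ws] Suc.prems ws by simp
  then show ?case using ws(3) by simp
qed auto

text \<open>\<open>X\<close> splits into the vertices on the cycle, half its length in number, the
  at most \<open>j\<close> small ones off it and the big ones off it. As \<open>k + j\<close> is at
  most \<open>a\<close>, the last kind suffices for all insertions up to length
  \<open>2 * k\<close>.\<close>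

lemma card_big_outside:
  assumes "is_cycle E vs" "card (X - B - set vs) \<le> j" "length vs \<le> 2 * k" "k + j \<le> a"
  shows "k - length vs div 2 \<le> card (X \<inter> B - set vs)"
proof -
  have "card X = card ((X \<inter> set vs) \<union> (X - B - set vs) \<union> (X \<inter> B - set vs))"
    by (rule arg_cong) blast
  then have "card X \<le> card (X \<inter> set vs) + card (X - B - set vs) + card (X \<inter> B - set vs)"
    using card_Un_le[of "X \<inter> set vs" "X - B - set vs"]
      card_Un_le[of "(X \<inter> set vs) \<union> (X - B - set vs)" "X \<inter> B - set vs"] by linarith
  then show ?thesis using is_cycle_balanced(1)[OF assms(1)] assms card_X by linarith
qed

text \<open>This reduces the theorem to short cycles: one that omits at most \<open>j\<close> small
  vertices on either side grows by insertions to every even length from its own up to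
  \<open>2 * (a - j)\<close>.\<close>

lemma cycle_of_length:
  assumes "is_cycle E vs" "4 \<le> length vs" "card (X - B - set vs) \<le> j" "card (Y - B - set vs) \<le> j"
    and "length vs \<le> 2 * k" "k + j \<le> a"
  shows "\<exists>ws. is_cycle E ws \<and> length ws = 2 * k"
proof -
  have "\<exists>ws. is_cycle E ws \<and> length ws = length vs + 2 * (k - length vs div 2)"
    using insert_big_pairs[OF assms(1,2)] card_big_outside near_complete_bipartite.card_big_outside[OF swapped] assms by metis
  moreover have "length vs + 2 * (k - length vs div 2) = 2 * k"
    using assms(5) by (simp flip: is_cycle_balanced(1)[OF assms(1)])
  ultimately show ?thesis by simp
qed

lemma hamiltonian:
  assumes "is_cycle E vs" "4 \<le> length vs" "(X \<union> Y) - B \<subseteq> set vs"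
  shows "\<exists>ws. is_cycle E ws \<and> length ws = 2 * a"
proof (rule cycle_of_length[OF assms(1,2)])
  have "X - B - set vs = {}" "Y - B - set vs = {}" using assms(3) by auto
  then show "card (X - B - set vs) \<le> 0" "card (Y - B - set vs) \<le> 0" by (simp_all only: card.empty)
  have "card (X \<inter> set vs) \<le> card X" using finite_X by (simp add: card_mono)
  then show "length vs \<le> 2 * a" using is_cycle_balanced(1)[OF assms(1)] card_X by simp
qed simp

section \<open>Counting small vertices\<close>

lemma card_small_X:
  assumes "Y \<inter> B \<noteq> {}"
  shows "card (X - B) \<le> 2"
proof (rule ccontr)
  assume "\<not> card (X - B) \<le> 2"
  then have "3 \<le> card (X - B)" by simp
  then obtain x0 x1 x2 where x: "x0 \<in> X - B" "x1 \<in> X - B" "x2 \<in> X - B" "distinct [x0, x1, x2]"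
    by (rule obtain_three_distinct)
  obtain y where "y \<in> Y" "y \<in> B" using assms by blast
  \<comment> \<open>\<open>y\<close> misses at most one in-arc, so at least two of the three small
    vertices dominate it, contrary to \<open>small\<close>.\<close>
  then show False using bigY(2)[of y] small[of _ _ y] x by (metis DiffE UnCI distinct_length_2_or_more)
qed

lemmas card_small_Y = near_complete_bipartite.card_small_X[OF swapped]

text \<open>A big vertex on one side leaves at most two small ones among the at least four vertices
  of the other side, which therefore has big vertices too.\<close>

lemma exists_bigs: "X \<inter> B \<noteq> {}" "Y \<inter> B \<noteq> {}"
proof -
  have "Y \<inter> B \<noteq> {}" if "X \<inter> B \<noteq> {}"
  proof
    assume "Y \<inter> B = {}"
    then have "Y - B = Y" by blast
    then show False using card_small_Y[OF that] card_Y a_ge_4 by simp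
  qed
  moreover have "X \<inter> B \<noteq> {}" if "Y \<inter> B \<noteq> {}"
  proof
    assume "X \<inter> B = {}"
    then have "X - B = X" by blast
    then show False using card_small_X[OF that] card_X a_ge_4 by simp
  qed
  ultimately show "X \<inter> B \<noteq> {}" "Y \<inter> B \<noteq> {}" using exists_big by blast+
qed

lemma card_big_X: "card (X \<inter> B) = a - card (X - B)"
  using card_Int_Diff[OF finite_X, of B] card_X by simp

lemmas card_big_Y = near_complete_bipartite.card_big_X[OF swapped]

text \<open>\<open>x0\<close> and \<open>x1\<close> cannot both dominate the big vertex
  \<open>y\<close>, and this missing arc is the only one that \<open>y\<close> can afford. All its
  other arcs with vertices of \<open>X\<close> are present.\<close>

lemma two_small_X:
  assumes "x0 \<in> X" "x1 \<in> X" "x0 \<notin> B" "x1 \<notin> B" "x0 \<noteq> x1" "y \<in> Y" "y \<in> B"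
  shows "\<And>x. x \<in> X \<Longrightarrow> E y x" "\<And>x. x \<in> X \<Longrightarrow> x \<in> B \<Longrightarrow> E x y" "E x0 y \<or> E x1 y"
proof -
  have *: "\<not> E x0 y \<or> \<not> E x1 y" using small assms by blast
  then show "\<And>x. x \<in> X \<Longrightarrow> E y x" "E x0 y \<or> E x1 y" using bigY[OF assms(6,7)] assms by metis+
  show "\<And>x. x \<in> X \<Longrightarrow> x \<in> B \<Longrightarrow> E x y" using * bigY(2)[OF assms(6,7)] assms by metis
qed

section \<open>Explicit cycles of lengths 4 to 10\<close>

lemma cycle4:
  assumes "u1 \<in> X \<union> Y" "E u1 v1" "E v1 u2" "E u2 v2" "E v2 u1" "u1 \<noteq> u2" "v1 \<noteq> v2"
  shows "is_cycle E [u1, v1, u2, v2]"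
proof -
  \<comment> \<open>Consecutive vertices lie in opposite partite sets, so distinctness has to be
    required only within each side.\<close>
  have "{u1, u2} \<subseteq> X \<and> {v1, v2} \<subseteq> Y \<or> {u1, u2} \<subseteq> Y \<and> {v1, v2} \<subseteq> X"
    using assms arcX arcY by blast
  then show ?thesis using assms disjoint unfolding is_cycle_def by fastforce
qed

lemma cycle6:
  assumes "u1 \<in> X \<union> Y" "E u1 v1" "E v1 u2" "E u2 v2" "E v2 u3" "E u3 v3" "E v3 u1"
    "distinct [u1, u2, u3]" "distinct [v1, v2, v3]"
  shows "is_cycle E [u1, v1, u2, v2, u3, v3]"
proof -
  have "{u1, u2, u3} \<subseteq> X \<and> {v1, v2, v3} \<subseteq> Y \<or> {u1, u2, u3} \<subseteq> Y \<and> {v1, v2, v3} \<subseteq> X"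
    using assms arcX arcY by blast
  then have "{u1, u2, u3} \<inter> {v1, v2, v3} = {}" using disjoint by blast
  then show ?thesis using assms unfolding is_cycle_def by auto
qed

lemma cycle8:
  assumes "u1 \<in> X \<union> Y" "E u1 v1" "E v1 u2" "E u2 v2" "E v2 u3" "E u3 v3" "E v3 u4" "E u4 v4" "E v4 u1"
    "distinct [u1, u2, u3, u4]" "distinct [v1, v2, v3, v4]"
  shows "is_cycle E [u1, v1, u2, v2, u3, v3, u4, v4]"
proof -
  have "{u1, u2, u3, u4} \<subseteq> X \<and> {v1, v2, v3, v4} \<subseteq> Y \<or> {u1, u2, u3, u4} \<subseteq> Y \<and> {v1, v2, v3, v4} \<subseteq> X"
    using assms arcX arcY by blast
  then have "{u1, u2, u3, u4} \<inter> {v1, v2, v3, v4} = {}" using disjoint by blast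
  then show ?thesis using assms unfolding is_cycle_def by auto
qed

lemma cycle10:
  assumes "u1 \<in> X \<union> Y" "E u1 v1" "E v1 u2" "E u2 v2" "E v2 u3" "E u3 v3" "E v3 u4" "E u4 v4"
    "E v4 u5" "E u5 v5" "E v5 u1"
    "distinct [u1, u2, u3, u4, u5]" "distinct [v1, v2, v3, v4, v5]"
  shows "is_cycle E [u1, v1, u2, v2, u3, v3, u4, v4, u5, v5]"
proof -
  have "{u1, u2, u3, u4, u5} \<subseteq> X \<and> {v1, v2, v3, v4, v5} \<subseteq> Y
      \<or> {u1, u2, u3, u4, u5} \<subseteq> Y \<and> {v1, v2, v3, v4, v5} \<subseteq> X"
    using assms arcX arcY by blast
  then have "{u1, u2, u3, u4, u5} \<inter> {v1, v2, v3, v4, v5} = {}" using disjoint by blast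
  then show ?thesis using assms unfolding is_cycle_def by auto
qed

subsection \<open>Cycles through the small vertices\<close>

text \<open>Strong connectivity applied to \<open>{x, z}\<close> and to its complement. It provides
  a way out of, or into, a pair of small vertices when \<open>x\<close> has no suitable big
  neighbour.\<close>

lemma arc_leaving_pair:
  assumes "x \<in> X" "z \<in> Y"
  shows "(\<exists>y\<in>Y. y \<noteq> z \<and> E x y) \<or> (\<exists>w\<in>X. w \<noteq> x \<and> E z w)"
    and "(\<exists>y\<in>Y. y \<noteq> z \<and> E y x) \<or> (\<exists>w\<in>X. w \<noteq> x \<and> E w z)"
proof -
  have "2 \<le> card X" using card_X a_ge_4 by simp
  then obtain w where "w \<in> X" "w \<noteq> x" by (metis obtain_two_distinct)
  then have w: "w \<in> X \<union> Y" "w \<notin> {x, z}" using assms disjoint by auto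
  have "\<exists>u\<in>{x, z}. \<exists>v\<in>X \<union> Y - {x, z}. E u v"
    by (rule cut) (use w assms in blast)+
  then show "(\<exists>y\<in>Y. y \<noteq> z \<and> E x y) \<or> (\<exists>w\<in>X. w \<noteq> x \<and> E z w)"
    using arcX[OF assms(1)] arcY[OF assms(2)] by auto
  have "\<exists>u\<in>X \<union> Y - {x, z}. \<exists>v\<in>X \<union> Y - (X \<union> Y - {x, z}). E u v"
    by (rule cut) (use w assms in blast)+
  then show "(\<exists>y\<in>Y. y \<noteq> z \<and> E y x) \<or> (\<exists>w\<in>X. w \<noteq> x \<and> E w z)"
    using arcX'[OF assms(1)] arcY'[OF assms(2)] by auto
qed

text \<open>The 6-cycle \<open>x, y1, w1, z, w2, y2\<close> can only fail because \<open>y1 \<rightarrow> w1\<close> or \<open>w2 \<rightarrow> y2\<close> is missing. The ends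
  of a missing arc have all their other arcs, which permits a detour through a third pair
  \<open>w3, y3\<close>, or else a different choice of the big neighbours of \<open>x\<close>.\<close>

lemma cycle_small_1_1_aux:
  assumes x: "x \<in> X" "x \<notin> B" and z: "z \<in> Y" "z \<notin> B"
    and cards: "3 \<le> card (X \<inter> B)" "3 \<le> card (Y \<inter> B)"
    and ex: "y \<in> Y \<inter> B" "E x y" "y' \<in> Y \<inter> B" "E y' x" "w \<in> X \<inter> B" "E w z" "w' \<in> X \<inter> B" "E z w'"
  shows "\<exists>vs. is_cycle E vs \<and> 4 \<le> length vs \<and> {x, z} \<subseteq> set vs"
proof -
  have adj: "\<And>y. y \<in> Y \<inter> B \<Longrightarrow> E x y \<or> E y x" "\<And>w. w \<in> X \<inter> B \<Longrightarrow> E w z \<or> E z w"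
    using bigX(4) bigY(4) x z by blast+
  have cards': "2 \<le> card (X \<inter> B)" "2 \<le> card (Y \<inter> B)" using cards by auto
  obtain y1 y2 where y: "y1 \<in> Y \<inter> B" "y2 \<in> Y \<inter> B" "y1 \<noteq> y2" "E x y1" "E y2 x"
    by (rule distinct_representatives[OF cards'(2) adj(1) ex(1-4)])
  obtain w1 w2 where w: "w1 \<in> X \<inter> B" "w2 \<in> X \<inter> B" "w1 \<noteq> w2" "E w1 z" "E z w2"
    by (rule distinct_representatives[OF cards'(1) adj(2) ex(5-8)])
  obtain y3 where y3: "y3 \<in> Y \<inter> B" "y3 \<noteq> y1" "y3 \<noteq> y2"
    using obtain_three_distinct[OF cards(2)] by (metis distinct_length_2_or_more)
  obtain w3 where w3: "w3 \<in> X \<inter> B" "w3 \<noteq> w1" "w3 \<noteq> w2"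
    using obtain_three_distinct[OF cards(1)] by (metis distinct_length_2_or_more)
  have ne: "x \<noteq> w1" "x \<noteq> w2" "x \<noteq> w3" "z \<noteq> y1" "z \<noteq> y2" "z \<noteq> y3"
    using x z w w3 y y3 by auto
  have full: "E x v \<and> E v x \<and> E u z \<and> E z u
      \<and> (\<forall>u'\<in>X. u' \<noteq> u \<longrightarrow> E v u') \<and> (\<forall>u'\<in>X. E u' v) \<and> (\<forall>v'\<in>Y. v' \<noteq> v \<longrightarrow> E v' u) \<and> (\<forall>v'\<in>Y. E u v')"
    if "\<not> E v u" "u \<in> X \<inter> B" "v \<in> Y \<inter> B" for u v
    using that bigX[of u] bigY[of v] x z by (metis IntD1 IntD2)
  have full': "E x v \<and> E v x \<and> E u z \<and> E z u
      \<and> (\<forall>u'\<in>X. u' \<noteq> u \<longrightarrow> E u' v) \<and> (\<forall>u'\<in>X. E v u') \<and> (\<forall>v'\<in>Y. v' \<noteq> v \<longrightarrow> E u v') \<and> (\<forall>v'\<in>Y. E v' u)"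
    if "\<not> E u v" "u \<in> X \<inter> B" "v \<in> Y \<inter> B" for u v
    using that bigX[of u] bigY[of v] x z by (metis IntD1 IntD2)
  have six: ?thesis
    if "E x y'" "E y' w'" "E w' z" "E z w''" "E w'' y''" "E y'' x" "y' \<noteq> y''" "w' \<noteq> w''"
      "{y', y''} \<subseteq> B" "{w', w''} \<subseteq> B" for y' y'' w' w''
    using cycle6[of x y' w' z w'' y''] that x z by fastforce
  have eight: ?thesis
    if "E x v1" "E v1 u2" "E u2 v2" "E v2 u3" "E u3 v3" "E v3 u4" "E u4 v4" "E v4 x"
      "distinct [x, u2, u3, u4]" "distinct [v1, v2, v3, v4]" "z \<in> {v1, v2, v3, v4}"
    for v1 u2 v2 u3 v3 u4 v4
    using cycle8[of x v1 u2 v2 u3 v3 u4 v4] that x by fastforce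
  show ?thesis
  proof (cases "E y1 w1")
    case True
    show ?thesis
    proof (cases "E w2 y2")
      case True
      with \<open>E y1 w1\<close> show ?thesis using six[of y1 w1 w2 y2] y w by auto
    next
      case False
      then have F: "E w2 y3" "E w3 y2" using full' y w y3 w3 by blast+
      show ?thesis
      proof (cases "E y3 w3")
        case True
        then show ?thesis using eight[of y1 w1 z w2 y3 w3 y2] F \<open>E y1 w1\<close> y w y3 w3 ne by auto
      next
        case False
        \<comment> \<open>\<open>y3\<close> already misses its arc to \<open>w3\<close>, so its arc
          to \<open>x\<close> is present and it can replace \<open>y2\<close>.\<close>
        then have "E y3 x" using full y3 w3 by blast
        then show ?thesis using six[of y1 w1 w2 y3] F \<open>E y1 w1\<close> y w y3 by auto
      qed
    qed
  next
    case False
    then have F: "E y2 w1" "E y1 x" "E y1 w3" "E y3 w1" "E y1 w2" "E w2 y1"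
      using full y w y3 w3 by blast+
    show ?thesis
    proof (cases "E w2 y2")
      case True
      show ?thesis
      proof (cases "E w3 y3")
        case True
        then show ?thesis using eight[of y1 w3 y3 w1 z w2 y2] F \<open>E w2 y2\<close> y w y3 w3 ne by auto
      next
        case False
        then have "E x y3" using full' y3 w3 by blast
        then show ?thesis using six[of y3 w1 w2 y2] F \<open>E w2 y2\<close> y w y3 by auto
      qed
    next
      case False
      then have "E x y2" using full' y w by blast
      \<comment> \<open>With both arcs missing, \<open>y1\<close> and \<open>y2\<close> are joined
        to \<open>x\<close> in both directions and exchange roles.\<close>
      then show ?thesis using six[of y2 w1 w2 y1] F y w by auto
    qed
  qed
qed

text \<open>The only out-neighbour of \<open>x\<close> is \<open>z\<close>, and
  \<open>arc_leaving_pair\<close> leads on from \<open>z\<close> to a big \<open>w\<close>. A big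
  \<open>y\<close> misses its arc from \<open>x\<close> and hence no other, so
  \<open>x, z, w, y\<close> closes up.\<close>

lemma cycle_small_1_1_no_out:
  assumes x: "x \<in> X" "x \<notin> B" and z: "z \<in> Y" "X - B = {x}" "Y - B = {z}"
    and no: "\<And>y. y \<in> Y \<inter> B \<Longrightarrow> \<not> E x y"
  shows "\<exists>vs. is_cycle E vs \<and> 4 \<le> length vs \<and> {x, z} \<subseteq> set vs"
proof -
  have only: "\<And>w. w \<in> X \<Longrightarrow> w = x \<or> w \<in> B" "\<And>y. y \<in> Y \<Longrightarrow> y = z \<or> y \<in> B"
    using z(2,3) by auto
  have "E x z" using out_neighbourX[OF x(1)] no only by blast
  obtain w where w: "w \<in> X" "w \<in> B" "w \<noteq> x" "E z w"
    using arc_leaving_pair(1)[OF x(1) z(1)] no only by blast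
  obtain y where y: "y \<in> Y" "y \<in> B" using exists_bigs by blast
  then have "E y x" "E w y" using no bigY[of y] x w by blast+
  then show ?thesis using cycle4[of x z w y] \<open>E x z\<close> x z w y
    by (intro exI[of _ "[x, z, w, y]"]) auto
qed

text \<open>The mirror image under arc reversal: \<open>z\<close> is the only in-neighbour of
  \<open>x\<close>, and the 4-cycle runs \<open>z, x, y, w\<close>.\<close>

lemma cycle_small_1_1_no_in:
  assumes x: "x \<in> X" "x \<notin> B" and z: "z \<in> Y" "X - B = {x}" "Y - B = {z}"
    and no: "\<And>y. y \<in> Y \<inter> B \<Longrightarrow> \<not> E y x"
  shows "\<exists>vs. is_cycle E vs \<and> 4 \<le> length vs \<and> {x, z} \<subseteq> set vs"
proof -
  have only: "\<And>w. w \<in> X \<Longrightarrow> w = x \<or> w \<in> B" "\<And>y. y \<in> Y \<Longrightarrow> y = z \<or> y \<in> B"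
    using z(2,3) by auto
  have "E z x" using in_neighbourX[OF x(1)] no only by blast
  obtain w where w: "w \<in> X" "w \<in> B" "w \<noteq> x" "E w z"
    using arc_leaving_pair(2)[OF x(1) z(1)] no only by blast
  obtain y where y: "y \<in> Y" "y \<in> B" using exists_bigs by blast
  then have "E x y" "E y w" using no bigY[of y] x w by blast+
  then show ?thesis using cycle4[of z x y w] \<open>E z x\<close> x z w y
    by (intro exI[of _ "[z, x, y, w]"]) auto
qed

lemma cycle_small_1_1:
  assumes z: "X - B = {x}" "Y - B = {z}"
  shows "\<exists>vs. is_cycle E vs \<and> 4 \<le> length vs \<and> (X \<union> Y) - B \<subseteq> set vs"
proof -
  have x: "x \<in> X" "x \<notin> B" "z \<in> Y" "z \<notin> B" using z by auto
  have cards: "3 \<le> card (X \<inter> B)" "3 \<le> card (Y \<inter> B)"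
    using card_big_X card_big_Y z a_ge_4 by auto
  consider "\<And>y. y \<in> Y \<inter> B \<Longrightarrow> \<not> E x y" | "\<And>y. y \<in> Y \<inter> B \<Longrightarrow> \<not> E y x"
    | "\<And>w. w \<in> X \<inter> B \<Longrightarrow> \<not> E z w" | "\<And>w. w \<in> X \<inter> B \<Longrightarrow> \<not> E w z"
    | "\<exists>y y' w w'. y \<in> Y \<inter> B \<and> E x y \<and> y' \<in> Y \<inter> B \<and> E y' x \<and> w \<in> X \<inter> B \<and> E w z \<and> w' \<in> X \<inter> B \<and> E z w'"
    by blast
  then have "\<exists>vs. is_cycle E vs \<and> 4 \<le> length vs \<and> {x, z} \<subseteq> set vs"
  proof cases
    case 1
    then show ?thesis by (rule cycle_small_1_1_no_out[OF x(1-3) z])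
  next
    case 2
    then show ?thesis by (rule cycle_small_1_1_no_in[OF x(1-3) z])
  next
    case 3
    from near_complete_bipartite.cycle_small_1_1_no_out[OF swapped x(3,4,1) z(2,1) this]
    show ?thesis by (simp add: insert_commute)
  next
    case 4
    from near_complete_bipartite.cycle_small_1_1_no_in[OF swapped x(3,4,1) z(2,1) this]
    show ?thesis by (simp add: insert_commute)
  next
    case 5
    then show ?thesis by (elim exE conjE) (rule cycle_small_1_1_aux[OF x cards])
  qed
  moreover have "(X \<union> Y) - B = {x, z}" using z by blast
  ultimately show ?thesis by simp
qed

text \<open>Among three big vertices of \<open>X\<close> at most one is not dominated by
  \<open>y1\<close> and at most one does not dominate \<open>y2\<close>, so one of them links
  \<open>y1\<close> to \<open>y2\<close> and closes a 4-cycle through \<open>x\<close>.\<close>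

lemma cycle_small_1_0:
  assumes x: "X - B = {x}" and Y: "Y \<subseteq> B"
  shows "\<exists>vs. is_cycle E vs \<and> 4 \<le> length vs \<and> (X \<union> Y) - B \<subseteq> set vs"
proof -
  have x': "x \<in> X" "x \<notin> B" using x by auto
  have cards: "2 \<le> card Y" "3 \<le> card (X \<inter> B)"
    using card_big_X card_Y x a_ge_4 by auto
  obtain u v where uv: "u \<in> Y" "E x u" "v \<in> Y" "E v x"
    using out_neighbourX[OF x'(1)] in_neighbourX[OF x'(1)] by blast
  have adj: "E x y \<or> E y x" if "y \<in> Y" for y using bigY(4)[of y x x] Y x' that by blast
  obtain y1 y2 where y: "y1 \<in> Y" "y2 \<in> Y" "y1 \<noteq> y2" "E x y1" "E y2 x"
    by (rule distinct_representatives[OF cards(1) adj uv])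
  obtain w1 w2 w3 where w: "w1 \<in> X \<inter> B" "w2 \<in> X \<inter> B" "w3 \<in> X \<inter> B" "distinct [w1, w2, w3]"
    by (rule obtain_three_distinct[OF cards(2)])
  have "\<exists>w\<in>{w1, w2, w3}. E y1 w \<and> E w y2"
    using bigY(1)[of y1] bigY(2)[of y2] w y Y
    by simp (metis IntD1 subsetD)
  then obtain w where "E y1 w" "E w y2" "w \<in> X \<inter> B" using w by blast
  then have "is_cycle E [x, y1, w, y2]" using cycle4[of x y1 w y2] y x' by auto
  moreover have "(X \<union> Y) - B = {x}" using x Y by blast
  ultimately show ?thesis by (intro exI[of _ "[x, y1, w, y2]"]) auto
qed

text \<open>By \<open>small\<close>, out-neighbours of \<open>x0\<close> and \<open>x1\<close>
  differ; being big, they dominate all of \<open>X\<close>, which gives a 4-cycle.\<close>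

lemma cycle_small_2_0:
  assumes x: "X - B = {x0, x1}" "x0 \<noteq> x1" and Y: "Y \<subseteq> B"
  shows "\<exists>vs. is_cycle E vs \<and> 4 \<le> length vs \<and> (X \<union> Y) - B \<subseteq> set vs"
proof -
  have x': "x0 \<in> X" "x1 \<in> X" "x0 \<notin> B" "x1 \<notin> B" using x by auto
  obtain y0 y1 where y: "E x0 y0" "E x1 y1" "y0 \<in> Y" "y1 \<in> Y"
    using out_neighbourX[OF x'(1)] out_neighbourX[OF x'(2)] by blast
  then have "y0 \<noteq> y1" "E y0 x1" "E y1 x0"
    using small[of x0 x1] two_small_X[OF x' x(2)] x' x(2) Y by blast+
  then have "is_cycle E [x0, y0, x1, y1]" using cycle4[of x0 y0 x1 y1] y x' x(2) by auto
  moreover have "(X \<union> Y) - B = {x0, x1}" using x Y by blast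
  ultimately show ?thesis by (intro exI[of _ "[x0, y0, x1, y1]"]) auto
qed

text \<open>\<open>x0\<close> can be left only through \<open>z\<close>, so every big vertex of
  \<open>Y\<close> is dominated by \<open>x1\<close>. The exit \<open>w\<close> from the pair
  \<open>x0, z\<close> is either big, giving a 6-cycle, or \<open>x1\<close> itself, giving a
  4-cycle.\<close>

lemma cycle_small_2_1_no_out:
  assumes x: "X - B = {x0, x1}" "x0 \<noteq> x1" and z: "Y - B = {z}"
    and no: "\<And>y. y \<in> Y \<inter> B \<Longrightarrow> \<not> E x0 y"
  shows "\<exists>vs. is_cycle E vs \<and> 4 \<le> length vs \<and> {x0, x1, z} \<subseteq> set vs"
proof -
  have only: "\<And>w. w \<in> X \<Longrightarrow> w = x0 \<or> w = x1 \<or> w \<in> B" "\<And>y. y \<in> Y \<Longrightarrow> y = z \<or> y \<in> B"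
    using x(1) z by auto
  have x': "x0 \<in> X" "x1 \<in> X" "x0 \<notin> B" "x1 \<notin> B" "z \<in> Y" "z \<notin> B" using x z by auto
  note full = two_small_X[OF x'(1-4) x(2)]
  have "3 \<le> card (Y \<inter> B)" using card_big_Y z a_ge_4 by simp
  then obtain y1 y2 where y: "y1 \<in> Y" "y1 \<in> B" "y2 \<in> Y" "y2 \<in> B" "y1 \<noteq> y2"
    by (elim obtain_three_distinct) auto
  have "E x0 z" using out_neighbourX[OF x'(1)] no only by blast
  have y1: "E x1 y1" "E y1 x0" "E y2 x1" using full y x' no by blast+
  obtain w where w: "w \<in> X" "w \<noteq> x0" "E z w"
    using arc_leaving_pair(1)[OF x'(1,5)] no only by blast
  show ?thesis
  proof (cases "w \<in> B")
    case True
    then have "E w y2" using full y w by blast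
    then have "is_cycle E [x0, z, w, y2, x1, y1]"
      using cycle6[of x0 z w y2 x1 y1] \<open>E x0 z\<close> w y1 x' x(2) y True by auto
    then show ?thesis by (intro exI[of _ "[x0, z, w, y2, x1, y1]"]) auto
  next
    case False
    then have "w = x1" using w only by blast
    then have "is_cycle E [x0, z, x1, y1]"
      using cycle4[of x0 z x1 y1] \<open>E x0 z\<close> w y1 x' x(2) y by auto
    then show ?thesis by (intro exI[of _ "[x0, z, x1, y1]"]) auto
  qed
qed

text \<open>Once \<open>x0\<close> and \<open>x1\<close> both have big out-neighbours, the cycle
  depends on how \<open>z\<close> is attached. If \<open>z\<close> lacks big in-neighbours or big
  out-neighbours, \<open>x0\<close> or \<open>x1\<close> takes their place in a 6-cycle; otherwise
  an 8-cycle passes through \<open>z\<close> between two big vertices.\<close>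

lemma cycle_small_2_1:
  assumes x: "X - B = {x0, x1}" "x0 \<noteq> x1" and z: "Y - B = {z}"
  shows "\<exists>vs. is_cycle E vs \<and> 4 \<le> length vs \<and> (X \<union> Y) - B \<subseteq> set vs"
proof -
  have only: "\<And>w. w \<in> X \<Longrightarrow> w = x0 \<or> w = x1 \<or> w \<in> B" "\<And>y. y \<in> Y \<Longrightarrow> y = z \<or> y \<in> B"
    using x(1) z by auto
  have x': "x0 \<in> X" "x1 \<in> X" "x0 \<notin> B" "x1 \<notin> B" "z \<in> Y" "z \<notin> B" using x z by auto
  note full = two_small_X[OF x'(1-4) x(2)]
  have cards: "3 \<le> card (Y \<inter> B)" "2 \<le> card (X \<inter> B)"
    using card_big_Y card_big_X x z a_ge_4 by auto
  have "\<exists>vs. is_cycle E vs \<and> 4 \<le> length vs \<and> {x0, x1, z} \<subseteq> set vs"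
  proof (cases "(\<exists>y. y \<in> Y \<inter> B \<and> E x0 y) \<and> (\<exists>y. y \<in> Y \<inter> B \<and> E x1 y)")
    case False
    have x_swap: "X - B = {x1, x0}" "x1 \<noteq> x0" using x by auto
    from False consider "\<And>y. y \<in> Y \<inter> B \<Longrightarrow> \<not> E x0 y" | "\<And>y. y \<in> Y \<inter> B \<Longrightarrow> \<not> E x1 y" by blast
    then show ?thesis
    proof cases
      case 1
      then show ?thesis by (rule cycle_small_2_1_no_out[OF x z])
    next
      case 2
      from cycle_small_2_1_no_out[OF x_swap z this] show ?thesis by (simp add: insert_commute)
    qed
  next
    case True
    then obtain y0 y1 where y: "y0 \<in> Y" "y0 \<in> B" "E x0 y0" "y1 \<in> Y" "y1 \<in> B" "E x1 y1" by blast
    have "y0 \<noteq> y1" using y small[of x0 x1] x' x(2) by blast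
    then obtain y2 where y2: "y2 \<in> Y" "y2 \<in> B" "y2 \<noteq> y0" "y2 \<noteq> y1"
      using obtain_three_distinct[OF cards(1)] by (metis IntD1 IntD2 distinct_length_2_or_more)
    obtain w where w: "w \<in> X" "w \<in> B" using exists_bigs by blast
    have adj: "\<And>w. w \<in> X \<inter> B \<Longrightarrow> E w z \<or> E z w" using bigX(4) x' by blast
    have six: ?thesis if "E u1 v1" "E v1 u2" "E u2 v2" "E v2 u3" "E u3 v3" "E v3 u1" "u1 \<in> X"
      "distinct [u1, u2, u3]" "distinct [v1, v2, v3]" "{x0, x1} \<subseteq> {u1, u2, u3}" "z \<in> {v1, v2, v3}"
      for u1 v1 u2 v2 u3 v3
      using cycle6[of u1 v1 u2 v2 u3 v3] that by (intro exI[of _ "[u1, v1, u2, v2, u3, v3]"]) auto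
    consider "\<And>w. w \<in> X \<inter> B \<Longrightarrow> \<not> E w z" | "\<And>w. w \<in> X \<inter> B \<Longrightarrow> \<not> E z w"
      | "\<exists>w w'. w \<in> X \<inter> B \<and> w' \<in> X \<inter> B \<and> E w z \<and> E z w'" by blast
    then show ?thesis
    proof cases
      case 1
      then have "E z w" using adj w by blast
      have "E x0 z \<or> E x1 z" using in_neighbourY[OF x'(5)] 1 only by blast
      moreover have "E w y2" "E y2 x0" "E y2 x1" "E y1 x0" "E y0 x1" using full y y2 w x' by blast+
      ultimately show ?thesis
        using six[of x0 z w y2 x1 y1] six[of x1 z w y2 x0 y0] \<open>E z w\<close> x' x(2) w y y2 by auto
    next
      case 2
      then have "E w z" using adj w by blast
      have "E z x0 \<or> E z x1" using out_neighbourY[OF x'(5)] 2 only by blast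
      moreover have "E y1 w" "E y0 w" "E y1 x0" "E y0 x1" using full y w x' by blast+
      ultimately show ?thesis
        using six[of x0 y0 x1 y1 w z] six[of x1 y1 x0 y0 w z] \<open>E w z\<close> x' x(2) w y \<open>y0 \<noteq> y1\<close> by auto
    next
      case 3
      then obtain w2 w3 where w: "w2 \<in> X \<inter> B" "w3 \<in> X \<inter> B" "w2 \<noteq> w3" "E w2 z" "E z w3"
        by (elim exE conjE) (rule distinct_representatives[OF cards(2) adj])
      have "E y0 w2" "E w3 y2" "E y2 x1" "E y1 x0" using full y y2 w x' by blast+
      then have "is_cycle E [x0, y0, w2, z, w3, y2, x1, y1]"
        using cycle8[of x0 y0 w2 z w3 y2 x1 y1] y y2 w x' x(2) \<open>y0 \<noteq> y1\<close> by auto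
      then show ?thesis by (intro exI[of _ "[x0, y0, w2, z, w3, y2, x1, y1]"]) auto
    qed
  qed
  moreover have "(X \<union> Y) - B = {x0, x1, z}" using x z by blast
  ultimately show ?thesis by simp
qed

text \<open>The arc between two small vertices saves a pair of big vertices: the 8-cycle needs just
  two on either side, which are available already for \<open>a = 4\<close>.\<close>

lemma cycle_small_2_2_arc:
  assumes x: "X - B = {x0, x1}" "x0 \<noteq> x1" and z: "Y - B = {z0, z1}" "z0 \<noteq> z1"
    and arcs: "E x0 z0" "y1 \<in> Y \<inter> B" "E x1 y1" "w0 \<in> X \<inter> B" "E z0 w0" "w1 \<in> X \<inter> B" "E z1 w1"
  shows "\<exists>vs. is_cycle E vs \<and> 4 \<le> length vs \<and> {x0, x1, z0, z1} \<subseteq> set vs"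
proof -
  have x': "x0 \<in> X" "x1 \<in> X" "x0 \<notin> B" "x1 \<notin> B" "z0 \<in> Y" "z1 \<in> Y" "z0 \<notin> B" "z1 \<notin> B"
    using x z by auto
  note fullY = two_small_X[OF x'(1-4) x(2)]
  note fullX = near_complete_bipartite.two_small_X[OF swapped x'(5-8) z(2)]
  have "2 \<le> card (Y \<inter> B)" using card_big_Y z a_ge_4 by simp
  then obtain y0 where y0: "y0 \<in> Y \<inter> B" "y0 \<noteq> y1" by (metis obtain_two_distinct)
  have "w0 \<noteq> w1" using small[of z0 z1] x' z(2) arcs by blast
  moreover have "E w0 z1" "E w1 y0" "E y0 x1" "E y1 x0" using fullX fullY x' y0 arcs by blast+
  ultimately have "is_cycle E [x0, z0, w0, z1, w1, y0, x1, y1]"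
    using cycle8[of x0 z0 w0 z1 w1 y0 x1 y1] arcs x' x(2) z(2) y0 by auto
  then show ?thesis by (intro exI[of _ "[x0, z0, w0, z1, w1, y0, x1, y1]"]) auto
qed

text \<open>As \<open>x0\<close> dominates no big vertex of \<open>Y\<close>, \<open>x1\<close>
  dominates all of them. If \<open>z\<close> and \<open>z'\<close> both have big out-neighbours, the
  preceding lemma applies. If one has none, the other dominates every big vertex of
  \<open>X\<close>, and this freedom yields an 8-cycle.\<close>

lemma cycle_small_2_2_no_out_arc:
  assumes x: "X - B = {x0, x1}" "x0 \<noteq> x1" and z: "Y - B = {z, z'}" "z \<noteq> z'"
    and no: "\<And>y. y \<in> Y \<inter> B \<Longrightarrow> \<not> E x0 y" and "E x0 z"
  shows "\<exists>vs. is_cycle E vs \<and> 4 \<le> length vs \<and> {x0, x1, z, z'} \<subseteq> set vs"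
proof -
  have x': "x0 \<in> X" "x1 \<in> X" "x0 \<notin> B" "x1 \<notin> B" "z \<in> Y" "z' \<in> Y" "z \<notin> B" "z' \<notin> B"
    using x z by auto
  have only: "\<And>w. w \<in> X \<Longrightarrow> w = x0 \<or> w = x1 \<or> w \<in> B" "\<And>y. y \<in> Y \<Longrightarrow> y = z \<or> y = z' \<or> y \<in> B"
    using x(1) z(1) by auto
  note fullY = two_small_X[OF x'(1-4) x(2)]
  note fullX = near_complete_bipartite.two_small_X[OF swapped x'(5-8) z(2)]
  have cards: "2 \<le> card (X \<inter> B)" "2 \<le> card (Y \<inter> B)"
    using card_big_X card_big_Y x z a_ge_4 by auto
  obtain y y' where y: "y \<in> Y \<inter> B" "y' \<in> Y \<inter> B" "y \<noteq> y'" by (rule obtain_two_distinct[OF cards(2)])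
  obtain w w' where w: "w \<in> X \<inter> B" "w' \<in> X \<inter> B" "w \<noteq> w'" by (rule obtain_two_distinct[OF cards(1)])
  have x1: "E x1 y" "E x1 y'" using fullY(3) no y by blast+
  have big: "E y u" "E y' u" if "u \<in> X" for u using fullY(1) that y by blast+
  have big': "E w v" "E w' v" if "v \<in> Y" for v using fullX(1) that w by blast+
  have eight: ?thesis if "E x0 z" "E z u2" "E u2 v2" "E v2 u3" "E u3 v3" "E v3 u4" "E u4 v4" "E v4 x0"
      "distinct [x0, u2, u3, u4]" "distinct [z, v2, v3, v4]" "x1 \<in> {u2, u3, u4}" "z' \<in> {v2, v3, v4}"
    for u2 v2 u3 v3 u4 v4
    using cycle8[of x0 z u2 v2 u3 v3 u4 v4] that x'
    by (intro exI[of _ "[x0, z, u2, v2, u3, v3, u4, v4]"]) auto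
  have ne: "x0 \<noteq> w" "x0 \<noteq> w'" "x1 \<noteq> w" "x1 \<noteq> w'" "z \<noteq> y" "z \<noteq> y'" "z' \<noteq> y" "z' \<noteq> y'"
    using x' y w by auto
  consider (both) w0 w1 where "w0 \<in> X \<inter> B" "E z w0" "w1 \<in> X \<inter> B" "E z' w1"
    | (none) "\<And>w. w \<in> X \<inter> B \<Longrightarrow> \<not> E z w"
    | (none') "\<And>w. w \<in> X \<inter> B \<Longrightarrow> \<not> E z' w" by blast
  then show ?thesis
  proof cases
    case both
    then show ?thesis using cycle_small_2_2_arc[OF x z \<open>E x0 z\<close> y(1) x1(1)] by blast
  next
    case none
    then have z': "E z' w" "E z' w'" using fullX(3) w by blast+
    show ?thesis
    proof (cases "E z x1")
      case True
      then show ?thesis using eight[of x1 y w z' w' y'] \<open>E x0 z\<close> x1 big big' z' ne x' x(2) z(2) y w by auto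
    next
      case False
      then have "E z x0" using out_neighbourY[OF x'(5)] none only by blast
      \<comment> \<open>Here \<open>z\<close> leads only back to \<open>x0\<close>, so the pair must
        be left from \<open>x0\<close>, and \<open>z'\<close> is the only remaining target.\<close>
      have "E x0 z'" using arc_leaving_pair(1)[OF x'(1,5)] no none False only by blast
      have "is_cycle E [x0, z', w', y, x1, y', w, z]"
        using cycle8[of x0 z' w' y x1 y' w z] \<open>E x0 z'\<close> \<open>E z x0\<close> x1 big big' z' ne x' x(2) z(2) y w by auto
      then show ?thesis by (intro exI[of _ "[x0, z', w', y, x1, y', w, z]"]) auto
    qed
  next
    case none'
    then have zw: "E z w" "E z w'" using fullX(3) w by blast+
    have "E z' x0 \<or> E z' x1" using out_neighbourY[OF x'(6)] none' only by blast
    then show ?thesis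
      using eight[of w y x1 y' w' z'] eight[of w z' x1 y w' y'] \<open>E x0 z\<close> x1 big big' zw ne x' x(2) z(2) y w
      by auto
  qed
qed

lemma cycle_small_2_2_no_out:
  assumes x: "X - B = {x0, x1}" "x0 \<noteq> x1" and z: "Y - B = {z, z'}" "z \<noteq> z'"
    and no: "\<And>y. y \<in> Y \<inter> B \<Longrightarrow> \<not> E x0 y"
  shows "\<exists>vs. is_cycle E vs \<and> 4 \<le> length vs \<and> {x0, x1, z, z'} \<subseteq> set vs"
proof -
  have "x0 \<in> X" "\<And>y. y \<in> Y \<Longrightarrow> y = z \<or> y = z' \<or> y \<in> B" using x(1) z(1) by auto
  then consider "E x0 z" | "E x0 z'" using out_neighbourX no by blast
  then show ?thesis
  proof cases
    case 1
    from cycle_small_2_2_no_out_arc[OF x z no this] show ?thesis by simp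
  next
    case 2
    have "Y - B = {z', z}" "z' \<noteq> z" using z by auto
    from cycle_small_2_2_no_out_arc[OF x this no 2] show ?thesis by (simp add: insert_commute)
  qed
qed

text \<open>The paths \<open>x0, y0, x1, y1\<close> and \<open>z0, w0, z1, w1\<close> cannot be
  joined directly without arcs between sides of equal kind; third big vertices \<open>w2\<close> and
  \<open>y2\<close>, which exist for \<open>a\<close> at least 5, link them into a 10-cycle.\<close>

lemma cycle_small_2_2_long:
  assumes x: "X - B = {x0, x1}" "x0 \<noteq> x1" and z: "Y - B = {z0, z1}" "z0 \<noteq> z1"
    and arcs: "y0 \<in> Y \<inter> B" "E x0 y0" "y1 \<in> Y \<inter> B" "E x1 y1" "w0 \<in> X \<inter> B" "E z0 w0" "w1 \<in> X \<inter> B" "E z1 w1"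
    and "5 \<le> a"
  shows "\<exists>vs. is_cycle E vs \<and> 4 \<le> length vs \<and> {x0, x1, z0, z1} \<subseteq> set vs"
proof -
  have x': "x0 \<in> X" "x1 \<in> X" "x0 \<notin> B" "x1 \<notin> B" "z0 \<in> Y" "z1 \<in> Y" "z0 \<notin> B" "z1 \<notin> B"
    using x z by auto
  note fullY = two_small_X[OF x'(1-4) x(2)]
  note fullX = near_complete_bipartite.two_small_X[OF swapped x'(5-8) z(2)]
  have cards: "3 \<le> card (X \<inter> B)" "3 \<le> card (Y \<inter> B)"
    using card_big_X card_big_Y x z \<open>5 \<le> a\<close> by auto
  obtain y2 where y2: "y2 \<in> Y \<inter> B" "y2 \<noteq> y0" "y2 \<noteq> y1"
    using obtain_three_distinct[OF cards(2)] by (metis distinct_length_2_or_more)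
  obtain w2 where w2: "w2 \<in> X \<inter> B" "w2 \<noteq> w0" "w2 \<noteq> w1"
    using obtain_three_distinct[OF cards(1)] by (metis distinct_length_2_or_more)
  have "w0 \<noteq> w1" "y0 \<noteq> y1" using small[of z0 z1] small[of x0 x1] x' x(2) z(2) arcs by blast+
  moreover have "E y0 x1" "E y1 w2" "E w2 z0" "E w0 z1" "E w1 y2" "E y2 x0"
    using fullX fullY x' y2 w2 arcs by blast+
  ultimately have "is_cycle E [x0, y0, x1, y1, w2, z0, w0, z1, w1, y2]"
    using cycle10[of x0 y0 x1 y1 w2 z0 w0 z1 w1 y2] arcs x' x(2) z(2) y2 w2 by auto
  then show ?thesis by (intro exI[of _ "[x0, y0, x1, y1, w2, z0, w0, z1, w1, y2]"]) auto
qed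

text \<open>Every adjacency is determined: big vertices dominate the whole opposite side,
  \<open>small\<close> leaves each of \<open>x0\<close>, \<open>x1\<close>, \<open>z0\<close>,
  \<open>z1\<close> one big out-neighbour, and small vertices are pairwise non-adjacent.\<close>

lemma cycle_small_2_2_D8:
  assumes x: "X - B = {x0, x1}" "x0 \<noteq> x1" and z: "Y - B = {z0, z1}" "z0 \<noteq> z1"
    and arcs: "y0 \<in> Y \<inter> B" "E x0 y0" "y1 \<in> Y \<inter> B" "E x1 y1" "w0 \<in> X \<inter> B" "E z0 w0" "w1 \<in> X \<inter> B" "E z1 w1"
    and no_arcs: "\<not> E x0 z0" "\<not> E x0 z1" "\<not> E x1 z0" "\<not> E x1 z1"
      "\<not> E z0 x0" "\<not> E z1 x0" "\<not> E z0 x1" "\<not> E z1 x1" and "a = 4"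
  shows "D8_embedding E (X \<union> Y)"
proof -
  have x': "x0 \<in> X" "x1 \<in> X" "x0 \<notin> B" "x1 \<notin> B" "z0 \<in> Y" "z1 \<in> Y" "z0 \<notin> B" "z1 \<notin> B"
    using x z by auto
  note fullY = two_small_X[OF x'(1-4) x(2)]
  note fullX = near_complete_bipartite.two_small_X[OF swapped x'(5-8) z(2)]
  have ne: "w0 \<noteq> w1" "y0 \<noteq> y1" using small[of z0 z1] small[of x0 x1] x' x(2) z(2) arcs by blast+
  have cards: "card (X \<inter> B) = 2" "card (Y \<inter> B) = 2"
    using card_big_X card_big_Y x z \<open>a = 4\<close> by auto
  have "{w0, w1} = X \<inter> B" "{y0, y1} = Y \<inter> B"
    using card_subset_eq[of "X \<inter> B" "{w0, w1}"] card_subset_eq[of "Y \<inter> B" "{y0, y1}"]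
      cards arcs ne finite_X finite_Y by auto
  then have XY: "X = {x0, x1, w0, w1}" "Y = {y0, y1, z0, z1}" using x z by blast+
  have pos: "\<forall>u\<in>X. E y0 u \<and> E y1 u" "\<forall>v\<in>Y. E w0 v \<and> E w1 v" using fullX(1) fullY(1) arcs by blast+
  have neg: "\<not> E x0 y1" "\<not> E x1 y0" "\<not> E z0 w1" "\<not> E z1 w0"
    using small[of z0 z1] small[of x0 x1] x' x(2) z(2) arcs by blast+
  have same: "\<forall>u\<in>X. \<forall>v\<in>X. \<not> E u v" "\<forall>u\<in>Y. \<forall>v\<in>Y. \<not> E u v" using arc disjoint by blast+
  \<comment> \<open>The small vertices become \<open>Xv 0\<close>, \<open>Xv 1\<close>,
    \<open>Yv 2\<close>, \<open>Yv 3\<close>, the big ones \<open>Xv 2\<close>, \<open>Xv 3\<close>,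
    \<open>Yv 0\<close>, \<open>Yv 1\<close>, each small vertex sharing its index with its big
    out-neighbour.\<close>
  define f where "f u = (case u of Xv i \<Rightarrow> [x0, x1, w0, w1] ! i | Yv i \<Rightarrow> [y0, y1, z0, z1] ! i)" for u
  have verts: "verts D8 = {Xv 0, Xv 1, Xv 2, Xv 3, Yv 0, Yv 1, Yv 2, Yv 3}"
    by (auto simp: D8_def numeral_eq_Suc lessThan_Suc)
  have two: "D8_two_cycles = {(Xv 0, Yv 0), (Xv 1, Yv 1), (Xv 2, Yv 2), (Xv 3, Yv 3),
      (Yv 0, Xv 2), (Yv 0, Xv 3), (Yv 1, Xv 2), (Yv 1, Xv 3)}"
    by (auto simp: D8_two_cycles_def numeral_eq_Suc less_Suc_eq)
  have f: "f (Xv 0) = x0" "f (Xv 1) = x1" "f (Xv 2) = w0" "f (Xv 3) = w1"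
    "f (Yv 0) = y0" "f (Yv 1) = y1" "f (Yv 2) = z0" "f (Yv 3) = z1"
    by (simp_all add: f_def)
  have dist: "distinct [x0, x1, w0, w1, y0, y1, z0, z1]"
    using x' x(2) z(2) ne arcs disjoint by auto
  have "inj_on f (verts D8)"
    unfolding verts using dist by (simp add: f del: One_nat_def)
  moreover have "f ` verts D8 = X \<union> Y" unfolding verts by (simp add: f XY del: One_nat_def) blast
  moreover have "\<forall>u\<in>verts D8. \<forall>v\<in>verts D8. E (f u) (f v) \<longleftrightarrow> (u, v) \<in> arcs D8"
    unfolding verts using pos neg same arcs no_arcs by (simp add: f XY D8_def two del: One_nat_def)
  ultimately show ?thesis unfolding D8_embedding_def by blast
qed

text \<open>If every small vertex has a big out-neighbour, any arc between small vertices becomes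
  \<open>x0\<close> to \<open>z0\<close> after renaming or swapping the sides. With no such arc,
  only the size of \<open>a\<close> decides.\<close>

lemma cycle_small_2_2:
  assumes x: "X - B = {x0, x1}" "x0 \<noteq> x1" and z: "Y - B = {z0, z1}" "z0 \<noteq> z1"
  shows "(\<exists>vs. is_cycle E vs \<and> 4 \<le> length vs \<and> (X \<union> Y) - B \<subseteq> set vs) \<or> D8_embedding E (X \<union> Y)"
proof -
  have x_swap: "X - B = {x1, x0}" "x1 \<noteq> x0" and z_swap: "Y - B = {z1, z0}" "z1 \<noteq> z0" using x z by auto
  note D = near_complete_bipartite.cycle_small_2_2_arc[OF swapped]
  let ?H = "\<exists>vs. is_cycle E vs \<and> 4 \<le> length vs \<and> {x0, x1, z0, z1} \<subseteq> set vs"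
  consider "\<And>y. y \<in> Y \<inter> B \<Longrightarrow> \<not> E x0 y" | "\<And>y. y \<in> Y \<inter> B \<Longrightarrow> \<not> E x1 y"
    | "\<And>w. w \<in> X \<inter> B \<Longrightarrow> \<not> E z0 w" | "\<And>w. w \<in> X \<inter> B \<Longrightarrow> \<not> E z1 w"
    | (all) y0 y1 w0 w1 where "y0 \<in> Y \<inter> B" "E x0 y0" "y1 \<in> Y \<inter> B" "E x1 y1"
      "w0 \<in> X \<inter> B" "E z0 w0" "w1 \<in> X \<inter> B" "E z1 w1" by blast
  then have "?H \<or> D8_embedding E (X \<union> Y)"
  proof cases
    case 1
    then show ?thesis using cycle_small_2_2_no_out[OF x z] by blast
  next
    case 2
    from cycle_small_2_2_no_out[OF x_swap z this] show ?thesis by (simp add: insert_commute)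
  next
    case 3
    from near_complete_bipartite.cycle_small_2_2_no_out[OF swapped z x this]
    show ?thesis by (simp add: insert_commute)
  next
    case 4
    from near_complete_bipartite.cycle_small_2_2_no_out[OF swapped z_swap x this]
    show ?thesis by (simp add: insert_commute)
  next
    case all
    consider "E x0 z0" | "E x0 z1" | "E x1 z0" | "E x1 z1" | "E z0 x0" | "E z0 x1" | "E z1 x0" | "E z1 x1"
      | (none) "\<not> E x0 z0" "\<not> E x0 z1" "\<not> E x1 z0" "\<not> E x1 z1"
        "\<not> E z0 x0" "\<not> E z1 x0" "\<not> E z0 x1" "\<not> E z1 x1" by blast
    then show ?thesis
    proof cases
      case 1
      from cycle_small_2_2_arc[OF x z 1 all(3-8)] show ?thesis by (simp add: insert_commute)
    next
      case 2
      from cycle_small_2_2_arc[OF x z_swap 2 all(3,4,7,8,5,6)] show ?thesis by (simp add: insert_commute)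
    next
      case 3
      from cycle_small_2_2_arc[OF x_swap z 3 all(1,2,5-8)] show ?thesis by (simp add: insert_commute)
    next
      case 4
      from cycle_small_2_2_arc[OF x_swap z_swap 4 all(1,2,7,8,5,6)] show ?thesis by (simp add: insert_commute)
    next
      case 5
      from D[OF z x 5 all(7,8,1-4)] show ?thesis by (simp add: insert_commute)
    next
      case 6
      from D[OF z x_swap 6 all(7,8,3,4,1,2)] show ?thesis by (simp add: insert_commute)
    next
      case 7
      from D[OF z_swap x 7 all(5,6,1-4)] show ?thesis by (simp add: insert_commute)
    next
      case 8
      from D[OF z_swap x_swap 8 all(5,6,3,4,1,2)] show ?thesis by (simp add: insert_commute)
    next
      case none
      show ?thesis
      proof (cases "a = 4")
        case True
        then show ?thesis using cycle_small_2_2_D8[OF x z all none] by blast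
      next
        case False
        then show ?thesis using cycle_small_2_2_long[OF x z all] a_ge_4 by simp
      qed
    qed
  qed
  moreover have "(X \<union> Y) - B = {x0, x1, z0, z1}" using x z by blast
  ultimately show ?thesis by simp
qed

section \<open>Cycles that avoid all or some small vertices\<close>

lemma big_cycle4: "\<exists>vs. is_cycle E vs \<and> length vs = 4"
proof (cases "card (X - B) = 2 \<or> card (Y - B) = 2")
  case True
  have "2 \<le> card (X \<inter> B)" "2 \<le> card (Y \<inter> B)"
    using card_big_X card_big_Y card_small_X card_small_Y exists_bigs a_ge_4 by auto
  then obtain w w' y y' where wy: "w \<in> X \<inter> B" "w' \<in> X \<inter> B" "w \<noteq> w'" "y \<in> Y \<inter> B" "y' \<in> Y \<inter> B" "y \<noteq> y'"
    by (elim obtain_two_distinct)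
  \<comment> \<open>Two small vertices on one side account for all missing arcs of the big vertices
    on the other, so big vertices are joined in both directions.\<close>
  have "E u v \<and> E v u" if "u \<in> X \<inter> B" "v \<in> Y \<inter> B" for u v
    using True
  proof
    assume "card (X - B) = 2"
    then obtain x0 x1 where "X - B = {x0, x1}" "x0 \<noteq> x1" by (auto simp: card_2_iff)
    then have "x0 \<in> X" "x1 \<in> X" "x0 \<notin> B" "x1 \<notin> B" by auto
    from two_small_X[OF this \<open>x0 \<noteq> x1\<close>] show ?thesis using that by blast
  next
    assume "card (Y - B) = 2"
    then obtain z0 z1 where "Y - B = {z0, z1}" "z0 \<noteq> z1" by (auto simp: card_2_iff)
    then have "z0 \<in> Y" "z1 \<in> Y" "z0 \<notin> B" "z1 \<notin> B" by auto
    from near_complete_bipartite.two_small_X[OF swapped this \<open>z0 \<noteq> z1\<close>] show ?thesis using that by blast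
  qed
  then have "is_cycle E [w, y, w', y']" using cycle4[of w y w' y'] wy by auto
  then show ?thesis by (intro exI[of _ "[w, y, w', y']"]) auto
next
  case False
  then have "card (X - B) < 2" "card (Y - B) < 2" using card_small_X card_small_Y exists_bigs by force+
  then have cards: "2 \<le> card (X \<inter> B)" "3 \<le> card (Y \<inter> B)" using card_big_X card_big_Y a_ge_4 by auto
  obtain w w' where w: "w \<in> X" "w \<in> B" "w' \<in> X" "w' \<in> B" "w \<noteq> w'"
    using obtain_two_distinct[OF cards(1)] by (metis IntD1 IntD2)
  obtain y1 y2 y3 where y: "y1 \<in> Y" "y2 \<in> Y" "y3 \<in> Y" "y1 \<noteq> y2" "y1 \<noteq> y3" "y2 \<noteq> y3"
    using obtain_three_distinct[OF cards(2)] by (metis IntD1 distinct_length_2_or_more)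
  note b = bigX[OF w(1,2)] and b' = bigX[OF w(3,4)]
  \<comment> \<open>The missing arcs of \<open>w\<close> and \<open>w'\<close> rule out at most two
    choices in total for \<open>y\<close> and \<open>y'\<close>, and three candidates leave room for
    distinct ones.\<close>
  have "\<exists>y\<in>{y1, y2, y3}. \<exists>y'\<in>{y1, y2, y3}. y \<noteq> y' \<and> E w y \<and> E y w' \<and> E w' y' \<and> E y' w"
    using y b b' by (smt (verit) insertCI)
  then obtain y y' where "y \<noteq> y'" "E w y" "E y w'" "E w' y'" "E y' w" by blast
  then have "is_cycle E [w, y, w', y']" using cycle4[of w y w' y'] w by auto
  then show ?thesis by (intro exI[of _ "[w, y, w', y']"]) auto
qed

text \<open>The missing arc of a big vertex can spoil its 2-cycle with only one of two opposite
  vertices.\<close>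

lemma cycle2: "\<exists>vs. is_cycle E vs \<and> length vs = 2"
proof -
  have "2 \<le> card Y" using card_Y a_ge_4 by simp
  then obtain y y' where y: "y \<in> Y" "y' \<in> Y" "y \<noteq> y'" by (rule obtain_two_distinct)
  obtain w where w: "w \<in> X" "w \<in> B" using exists_bigs by blast
  have "E w y \<and> E y w \<or> E w y' \<and> E y' w" using bigX[OF w] y by metis
  then obtain v where "v \<in> Y" "E w v" "E v w" using y by blast
  moreover from this have "w \<noteq> v" using w disjoint by blast
  ultimately show ?thesis by (intro exI[of _ "[w, v]"]) (simp add: is_cycle_def)
qed

text \<open>With two small vertices on a side, extending an all-big 4-cycle stops at length
  \<open>2 * (a - 2)\<close>. Starting from a 4-cycle or 6-cycle that leaves at most one small
  vertex per side uncovered gains the next length; the 6-cycle just fits when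
  \<open>a = 4\<close>.\<close>

lemma cycle_omitting_two:
  assumes "card (X - B) = 2"
  shows "\<exists>vs. is_cycle E vs \<and> length vs = 2 * (a - 1)"
proof -
  obtain x0 x1 where x01: "X - B = {x0, x1}" "x0 \<noteq> x1" using assms by (auto simp: card_2_iff)
  then have x': "x0 \<in> X" "x1 \<in> X" "x0 \<notin> B" "x1 \<notin> B" by auto
  note fullY = two_small_X[OF x' x01(2)]
  have "2 \<le> card (Y \<inter> B)"
    using card_big_Y card_small_Y exists_bigs a_ge_4 by auto
  then obtain y y' where y: "y \<in> Y \<inter> B" "y' \<in> Y \<inter> B" "y \<noteq> y'" by (rule obtain_two_distinct)
  have "E x0 y \<or> E x1 y" using fullY(3) y by blast
  then obtain x where x: "x \<in> X" "x \<notin> B" "E x y" using x' by blast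
  \<comment> \<open>Both starting cycles below are listed from the small vertex \<open>x\<close>, so
    one bound serves for both.\<close>
  have "X - B - set (x # vs) \<subseteq> X - B - {x}" for vs by auto
  moreover have "card (X - B - {x}) = 1" using assms x by simp
  ultimately have card_X1: "card (X - B - set (x # vs)) \<le> 1" for vs
    using card_mono finite_X by (metis finite_Diff)
  have y'x: "E y' x" using fullY(1) x y by blast
  obtain vs where "is_cycle E (x # vs)" "4 \<le> length (x # vs)" "length (x # vs) \<le> 2 * (a - 1)"
    "card (Y - B - set (x # vs)) \<le> 1"
  proof (cases "card (Y - B) = 2")
    case True
    then obtain z0 z1 where z01: "Y - B = {z0, z1}" "z0 \<noteq> z1" by (auto simp: card_2_iff)
    then have z': "z0 \<in> Y" "z1 \<in> Y" "z0 \<notin> B" "z1 \<notin> B" by auto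
    note fullX = near_complete_bipartite.two_small_X[OF swapped z' z01(2)]
    have "2 \<le> card (X \<inter> B)"
      using card_big_X assms a_ge_4 by auto
    then obtain w w' where w: "w \<in> X \<inter> B" "w' \<in> X \<inter> B" "w \<noteq> w'" by (rule obtain_two_distinct)
    have "E z0 w' \<or> E z1 w'" using fullX(3) w by blast
    then obtain z where z: "z \<in> Y" "z \<notin> B" "E z w'" using z' by blast
    have "E y w" "E w z" "E w' y'" using fullX(1) fullY w y z by blast+
    then have "is_cycle E [x, y, w, z, w', y']"
      using cycle6[of x y w z w' y'] x y'x y w z by auto
    moreover have "card (Y - B - {z}) = 1" using True z by simp
    then have "card (Y - B - set [x, y, w, z, w', y']) \<le> 1"
      using card_mono[of "Y - B - {z}" "Y - B - set [x, y, w, z, w', y']"] finite_Y by fastforce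
    ultimately show thesis using a_ge_4 by (intro that[of "[y, w, z, w', y']"]) auto
  next
    case False
    obtain w where w: "w \<in> X" "w \<in> B" using exists_bigs by blast
    have "E y w" "E w y'" using fullY w y by blast+
    then have "is_cycle E [x, y, w, y']" using cycle4[of x y w y'] x y'x y w by auto
    moreover have "card (Y - B) \<le> 1" using False card_small_Y[OF exists_bigs(1)] by simp
    then have "card (Y - B - set [x, y, w, y']) \<le> 1"
      using card_mono[of "Y - B" "Y - B - set [x, y, w, y']"] finite_Y by fastforce
    ultimately show thesis using a_ge_4 by (intro that[of "[y, w, y']"]) auto
  qed
  then show ?thesis using cycle_of_length[OF _ _ card_X1] a_ge_4 by simp
qed

text \<open>With at most two small vertices per side and no more in \<open>Y\<close> than in
  \<open>X\<close>, six cases remain, each settled above.\<close>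

lemma cycle_through_small:
  assumes "card (Y - B) \<le> card (X - B)"
  shows "(\<exists>vs. is_cycle E vs \<and> 4 \<le> length vs \<and> (X \<union> Y) - B \<subseteq> set vs) \<or> D8_embedding E (X \<union> Y)"
proof -
  have fin: "finite (X - B)" "finite (Y - B)" using finite_X finite_Y by auto
  have "card (X - B) \<le> 2" using card_small_X exists_bigs by blast
  then consider "card (X - B) = 0" | "card (X - B) = 1" | "card (X - B) = 2" by linarith
  then show ?thesis
  proof cases
    case 1
    then have "card (Y - B) = 0" using assms by simp
    with 1 have "X - B = {}" "Y - B = {}" using fin by (metis card_0_eq)+
    then have "(X \<union> Y) - B \<subseteq> set vs" for vs by blast
    moreover obtain vs where "is_cycle E vs" "length vs = 4" using big_cycle4 by blast
    ultimately show ?thesis by (metis order_refl)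
  next
    case 2
    then obtain x where x: "X - B = {x}" by (metis card_1_singletonE)
    have "card (Y - B) = 0 \<or> card (Y - B) = 1" using 2 assms by linarith
    then consider "Y - B = {}" | z where "Y - B = {z}" using fin by (metis card_1_singletonE card_0_eq)
    then show ?thesis
    proof cases
      case 1
      then show ?thesis using cycle_small_1_0[OF x] by simp
    next
      case 2
      then show ?thesis using cycle_small_1_1[OF x] by simp
    qed
  next
    case 3
    then obtain x0 x1 where x: "X - B = {x0, x1}" "x0 \<noteq> x1" by (auto simp: card_2_iff)
    have "card (Y - B) = 0 \<or> card (Y - B) = 1 \<or> card (Y - B) = 2" using 3 assms by linarith
    then consider "Y - B = {}" | z where "Y - B = {z}" | z0 z1 where "Y - B = {z0, z1}" "z0 \<noteq> z1"
      using fin by (metis card_1_singletonE card_0_eq card_2_iff)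
    then show ?thesis
    proof cases
      case 1
      then show ?thesis using cycle_small_2_0[OF x] by simp
    next
      case 2
      then show ?thesis using cycle_small_2_1[OF x] by simp
    next
      case 3
      then show ?thesis by (rule cycle_small_2_2[OF x])
    qed
  qed
qed

section \<open>Assembling all even lengths\<close>

lemma hamiltonian_or_D8: "(\<exists>vs. is_cycle E vs \<and> length vs = 2 * a) \<or> D8_embedding E (X \<union> Y)"
proof (cases "card (Y - B) \<le> card (X - B)")
  case True
  then show ?thesis using cycle_through_small hamiltonian by blast
next
  case False
  then have "card (X - B) \<le> card (Y - B)" by simp
  from near_complete_bipartite.cycle_through_small[OF swapped this] show ?thesis
    using hamiltonian by (metis Un_commute)
qed

theorem all_even_cycles_or_D8:
  "(\<forall>k. 1 \<le> k \<and> k \<le> a \<longrightarrow> (\<exists>vs. is_cycle E vs \<and> length vs = 2 * k)) \<or> D8_embedding E (X \<union> Y)"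
proof (intro disjCI allI impI)
  fix k assume noD8: "\<not> D8_embedding E (X \<union> Y)" and k: "1 \<le> k \<and> k \<le> a"
  let ?j = "max (card (X - B)) (card (Y - B))"
  have "?j \<le> 2" using card_small_X card_small_Y exists_bigs by simp
  \<comment> \<open>Extending an all-big 4-cycle reaches \<open>k = a - ?j\<close>. Beyond that lie
    only \<open>k = a\<close> and, when \<open>?j = 2\<close>, also
    \<open>k = a - 1\<close>.\<close>
  with k consider "k = 1" | "2 \<le> k" "k + ?j \<le> a" | "k = a" | "?j = 2" "k = a - 1" by linarith
  then show "\<exists>vs. is_cycle E vs \<and> length vs = 2 * k"
  proof cases
    case 1
    then show ?thesis using cycle2 by simp
  next
    case 2
    obtain vs where vs: "is_cycle E vs" "length vs = 4" using big_cycle4 by blast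
    have "card (X - B - set vs) \<le> card (X - B)" "card (Y - B - set vs) \<le> card (Y - B)"
      using finite_X finite_Y by (simp_all add: card_mono Diff_subset)
    then have "card (X - B - set vs) \<le> ?j" "card (Y - B - set vs) \<le> ?j" by linarith+
    then show ?thesis using cycle_of_length[OF vs(1)] vs(2) 2 by simp
  next
    case 3
    then show ?thesis using hamiltonian_or_D8 noD8 by blast
  next
    case 4
    then have "card (X - B) = 2 \<or> card (Y - B) = 2" by linarith
    then show ?thesis
      using cycle_omitting_two near_complete_bipartite.cycle_omitting_two[OF swapped] 4 by blast
  qed
qed

end

subsection \<open>Digraphs\<close>

context wf_digraph
begin

lemma awalk_through_list:
  assumes "successively (\<lambda>u v. u \<rightarrow>\<^bsub>G\<^esub> v) (u # ws)" "u \<in> verts G"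
  shows "\<exists>p. awalk u p (last (u # ws)) \<and> awalk_verts u p = u # ws"
  using assms
proof (induction ws arbitrary: u)
  case Nil
  then show ?case by (intro exI[of _ "[]"]) (simp add: awalk_Nil_iff)
next
  case (Cons w ws)
  then obtain e where e: "e \<in> arcs G" "tail G e = u" "head G e = w"
    by (auto simp: arcs_ends_conv)
  then have "w \<in> verts G" by auto
  then obtain p where "awalk w p (last (w # ws))" "awalk_verts w p = w # ws"
    using Cons by force
  then show ?case using e Cons.prems by (intro exI[of _ "e # p"]) (simp add: awalk_Cons_iff)
qed

lemma has_cycle_of_length_if_is_cycle:
  assumes "is_cycle (\<lambda>u v. u \<rightarrow>\<^bsub>G\<^esub> v) vs"
  shows "has_cycle_of_length G (length vs)"
proof -
  obtain u ws where vs: "vs = u # ws" using assms by (cases vs) (auto simp: is_cycle_def)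
  have succ: "successively (\<lambda>u v. u \<rightarrow>\<^bsub>G\<^esub> v) (u # ws @ [u])" and dist: "distinct (u # ws)"
    using assms by (simp_all add: is_cycle_def vs)
  have "u \<in> verts G" using succ by (cases ws) auto
  then obtain p where p: "awalk u p u" "awalk_verts u p = u # ws @ [u]"
    using awalk_through_list[OF succ] by auto
  have "length p = length vs" using p(2) length_awalk_verts[of u p] by (simp add: vs)
  moreover have "cycle p" unfolding cycle_def using p dist \<open>length p = length vs\<close> vs by auto
  ultimately show ?thesis unfolding has_cycle_of_length_def by blast
qed

text \<open>If no arc left \<open>S\<close>, everything reachable from a vertex of \<open>S\<close>
  would stay in \<open>S\<close>.\<close>

lemma strongly_connected_cut:
  assumes "strongly_connected G" "S \<subseteq> verts G" "S \<noteq> {}" "S \<noteq> verts G"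
  shows "\<exists>u\<in>S. \<exists>v\<in>verts G - S. u \<rightarrow>\<^bsub>G\<^esub> v"
proof (rule ccontr)
  assume *: "\<not> ?thesis"
  obtain u v where uv: "u \<in> S" "v \<in> verts G - S" using assms by blast
  then have "u \<rightarrow>\<^sup>*\<^bsub>G\<^esub> v" using assms(1,2) unfolding strongly_connected_def by blast
  then have "(u, v) \<in> (arcs_ends G)\<^sup>*" by (rule reachable_rtranclI)
  then have "v \<in> S" using uv(1) * by (induction rule: rtrancl_induct) (auto dest: adj_in_verts(2))
  then show False using uv by blast
qed

end

text \<open>Without multiple arcs, an arc at \<open>v\<close> is determined by its other end, so
  counting arcs is counting neighbours.\<close>

lemma (in nomulti_digraph) degree_conv_neighbours:
  "degree G v = card {u. v \<rightarrow>\<^bsub>G\<^esub> u} + card {u. u \<rightarrow>\<^bsub>G\<^esub> v}"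
proof -
  have "inj_on (head G) (out_arcs G v)" "inj_on (tail G) (in_arcs G v)"
    using no_multi_arcs by (auto simp: inj_on_def arc_to_ends_def in_arcs_def out_arcs_def)
  moreover have "{u. v \<rightarrow>\<^bsub>G\<^esub> u} = head G ` out_arcs G v" "{u. u \<rightarrow>\<^bsub>G\<^esub> v} = tail G ` in_arcs G v"
    by (auto simp: arcs_ends_conv out_arcs_def in_arcs_def)
  ultimately show ?thesis
    by (simp add: degree_def out_degree_def in_degree_def card_image)
qed

text \<open>Every arc entering a vertex of a cycle is an arc of that cycle, so by strong connectivity
  every vertex lies on it.\<close>

lemma (in digraph) is_directed_cycle_if_unique_in_neighbours:
  assumes "strongly_connected G" "2 \<le> card (verts G)"
    and unique: "\<And>u v w. u \<rightarrow>\<^bsub>G\<^esub> w \<Longrightarrow> v \<rightarrow>\<^bsub>G\<^esub> w \<Longrightarrow> u = v"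
  shows "is_directed_cycle G"
proof -
  obtain x y where xy: "x \<in> verts G" "y \<in> verts G" "x \<noteq> y"
    by (rule obtain_two_distinct[OF assms(2)])
  then obtain q r where qr: "awalk x q y" "awalk y r x"
    using assms(1) unfolding strongly_connected_def reachable_awalk by blast
  then have "awalk x (q @ r) x" "q \<noteq> []" using xy by (auto simp: awalk_Nil_iff)
  then have "closed_w (q @ r)" unfolding closed_w_def by auto
  then obtain p where cyc: "cycle p" using closed_w_imp_cycle by blast
  then obtain u where p: "awalk u p u" "p \<noteq> []" unfolding cycle_def by blast
  let ?S = "set (awalk_verts u p)"
  have "?S \<subseteq> verts G" "set p \<subseteq> arcs G" using p(1) by (blast elim: awalkE)+
  have heads: "\<exists>e\<in>set p. head G e = v \<and> tail G e \<in> ?S" if "v \<in> ?S" for v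
  proof -
    have verts: "awalk_verts u p = map (tail G) p @ [head G (last p)]"
      "awalk_verts u p = tail G (hd p) # map (head G) p"
      using awalk_verts_conv[of u p] awalk_verts_conv'[of u p u] p by (auto simp: awalk_def)
    have "hd (awalk_verts u p) = last (awalk_verts u p)" using p(1) by (metis awalkE)
    moreover have "hd (awalk_verts u p) = tail G (hd p)" unfolding verts(2) by simp
    moreover have "last (awalk_verts u p) = head G (last p)" unfolding verts(1) by simp
    ultimately have "tail G (hd p) = head G (last p)" by simp
    moreover have "head G (last p) \<in> head G ` set p" using p(2) by simp
    moreover have "?S = insert (tail G (hd p)) (head G ` set p)" unfolding verts(2) by simp
    \<comment> \<open>The start vertex is also the head of the last arc, so every vertex of the
      closed walk is a head.\<close>
    ultimately have "?S = head G ` set p" by (simp only: insert_absorb)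
    with that have "v \<in> head G ` set p" by simp
    then obtain e where "e \<in> set p" "v = head G e" by blast
    moreover from this have "tail G e \<in> ?S" unfolding verts(1) by simp
    ultimately show ?thesis by blast
  qed
  have "?S = verts G"
  proof (rule ccontr)
    assume "?S \<noteq> verts G"
    then have "verts G - ?S \<noteq> {}" using \<open>?S \<subseteq> verts G\<close> by simp
    moreover have "u \<in> ?S" using p(1) by (rule hd_in_awalk_verts)
    then have "verts G - ?S \<noteq> verts G" using \<open>?S \<subseteq> verts G\<close> by blast
    \<comment> \<open>The cut is taken around the complement, to obtain an arc that enters the cycle
      from outside.\<close>
    ultimately have "\<exists>w\<in>verts G - ?S. \<exists>v\<in>verts G - (verts G - ?S). w \<rightarrow>\<^bsub>G\<^esub> v"
      using strongly_connected_cut[OF assms(1) Diff_subset] by blast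
    then obtain w v where wv: "w \<in> verts G - ?S" "v \<in> ?S" "w \<rightarrow>\<^bsub>G\<^esub> v" by blast
    then obtain e where e: "e \<in> set p" "head G e = v" "tail G e \<in> ?S" using heads by blast
    then have "tail G e \<rightarrow>\<^bsub>G\<^esub> v" using \<open>set p \<subseteq> arcs G\<close> by (auto simp: arcs_ends_conv)
    then show False using unique[OF wv(3)] wv(1) e(3) by blast
  qed
  moreover have "arcs G \<subseteq> set p"
  proof
    fix e assume e: "e \<in> arcs G"
    then have "head G e \<in> ?S" using \<open>?S = verts G\<close> by simp
    then obtain e' where e': "e' \<in> set p" "head G e' = head G e" using heads by blast
    then have "e' \<in> arcs G" using \<open>set p \<subseteq> arcs G\<close> by blast
    then have "tail G e' = tail G e" using unique[of "tail G e'" "head G e" "tail G e"] e e'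
      by (force simp: arcs_ends_conv)
    then have "e' = e" using no_multi_arcs[OF \<open>e' \<in> arcs G\<close> e] e' by (simp add: arc_to_ends_def)
    then show "e \<in> set p" using e' by simp
  qed
  ultimately show ?thesis
    unfolding is_directed_cycle_def using cyc p(1) \<open>set p \<subseteq> arcs G\<close> by blast
qed

lemma (in digraph) digraph_iso_D8_if_embedding:
  assumes "D8_embedding (\<lambda>u v. u \<rightarrow>\<^bsub>G\<^esub> v) (verts G)"
  shows "digraph_iso G D8"
proof -
  obtain f where inj: "inj_on f (verts D8)" and img: "f ` verts D8 = verts G"
    and adj: "\<And>u v. u \<in> verts D8 \<Longrightarrow> v \<in> verts D8 \<Longrightarrow> f u \<rightarrow>\<^bsub>G\<^esub> f v \<longleftrightarrow> (u, v) \<in> arcs D8"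
    using assms unfolding D8_embedding_def by blast
  define g where "g = the_inv_into (verts D8) f"
  have gf: "g (f u) = u" if "u \<in> verts D8" for u using that inj by (simp add: g_def the_inv_into_f_f)
  have fg: "g v \<in> verts D8 \<and> f (g v) = v" if "v \<in> verts G" for v
    using that unfolding img[symmetric] by (auto simp: gf)
  have ends: "tail D8 = fst" "head D8 = snd" by (simp_all add: D8_def)
  \<comment> \<open>The isomorphism runs from \<open>G\<close> to \<open>D8\<close>, hence the
    inverse \<open>g\<close>; arcs go to the pairs of images of their ends, with the projections of
    \<open>D8\<close> as end maps.\<close>
  define h where "h = \<lparr> iso_verts = g, iso_arcs = (\<lambda>e. (g (tail G e), g (head G e))),
    iso_head = (snd :: d8_vertex \<times> d8_vertex \<Rightarrow> _), iso_tail = fst \<rparr>"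
  have "inj_on g (verts G)" using fg by (metis inj_onI)
  moreover have "inj_on (\<lambda>e. (g (tail G e), g (head G e))) (arcs G)"
    using fg no_multi_arcs unfolding inj_on_def arc_to_ends_def
    by (metis Pair_inject head_in_verts tail_in_verts)
  ultimately have "digraph_isomorphism h"
    unfolding digraph_isomorphism_def h_def using wf_digraph by simp
  moreover have "D8 = app_iso h G"
  proof -
    have "verts D8 = g ` verts G" using img gf by force
    moreover have "arcs D8 = (\<lambda>e. (g (tail G e), g (head G e))) ` arcs G"
    proof
      show "(\<lambda>e. (g (tail G e), g (head G e))) ` arcs G \<subseteq> arcs D8"
        using adj fg by (auto simp: arcs_ends_conv) (metis (mono_tags, lifting) image_eqI head_in_verts tail_in_verts)
      show "arcs D8 \<subseteq> (\<lambda>e. (g (tail G e), g (head G e))) ` arcs G"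
      proof
        fix a assume a: "a \<in> arcs D8"
        obtain u v where uv: "a = (u, v)" by (cases a)
        interpret D8: digraph D8 by (rule digraph_D8)
        have "u \<in> verts D8" "v \<in> verts D8"
          using D8.tail_in_verts[OF a] D8.head_in_verts[OF a] by (simp_all add: ends uv)
        then have "f u \<rightarrow>\<^bsub>G\<^esub> f v" using adj a uv by simp
        then obtain e where "e \<in> arcs G" "tail G e = f u" "head G e = f v"
          by (auto simp: arcs_ends_conv)
        then show "a \<in> (\<lambda>e. (g (tail G e), g (head G e))) ` arcs G"
          using gf uv \<open>u \<in> verts D8\<close> \<open>v \<in> verts D8\<close> by force
      qed
    qed
    ultimately show ?thesis by (simp add: app_iso_def h_def ends[symmetric])
  qed
  ultimately show ?thesis unfolding digraph_iso_def by blast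
qed

section \<open>From degrees to missing arcs\<close>

lemma card_missing_neighbours:
  assumes "finite Y" "card Y = a" "P \<subseteq> Y" "Q \<subseteq> Y" "2 * a - 1 \<le> card P + card Q"
  shows "card (Y - P) + card (Y - Q) \<le> 1"
proof -
  have "card (Y - P) = a - card P" "card (Y - Q) = a - card Q"
    using assms by (simp_all add: card_Diff_subset finite_subset)
  moreover have "card P \<le> a" "card Q \<le> a" using assms card_mono by blast+
  ultimately show ?thesis using assms(5) by linarith
qed

theorem theorem1p10:
  fixes D :: "('a,'b) pre_digraph" and X Y :: "'a set" and a :: nat
  assumes "digraph D"
    and "strongly_connected D"
    and "balanced_bipartition D X Y"
    and "card (verts D) = 2 * a" and "2 * a \<ge> 8"
    and "\<not> is_directed_cycle D"
    and "\<forall>x y. dominating_pair D x y \<longrightarrow> max (degree D x) (degree D y) \<ge> 2 * a - 1"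
  shows "(\<forall>k. 1 \<le> k \<and> k \<le> a \<longrightarrow> has_cycle_of_length D (2 * k)) \<or> digraph_iso D D8"
proof -
  interpret digraph D by (rule assms(1))
  define E where "E u v \<longleftrightarrow> u \<rightarrow>\<^bsub>D\<^esub> v" for u v
  define B where "B = {v. 2 * a - 1 \<le> degree D v}"
  have XY: "X \<union> Y = verts D" "X \<inter> Y = {}" and card_eq: "card X = card Y"
    and arc: "\<And>u v. E u v \<Longrightarrow> u \<in> X \<and> v \<in> Y \<or> u \<in> Y \<and> v \<in> X"
    using assms(3) by (auto simp: balanced_bipartition_def bipartition_def E_def arcs_ends_conv)
  have fin: "finite X" "finite Y" using XY(1) finite_verts by (metis finite_Un)+
  then have cards: "card X = a" "card Y = a"
    using card_Un_disjoint[of X Y] XY assms(4) card_eq by auto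
  have small: "u = v" if "u \<in> X \<union> Y" "v \<in> X \<union> Y" "u \<notin> B" "v \<notin> B" "E u z" "E v z" for u v z
  proof (rule ccontr)
    assume "u \<noteq> v"
    have "z \<in> verts D" using arc[OF that(5)] XY by blast
    then have "dominating_pair D u v"
      using that \<open>u \<noteq> v\<close> XY by (auto simp: dominating_pair_def E_def)
    then show False using assms(7) that(3,4) by (fastforce simp: B_def)
  qed
  \<comment> \<open>At \<open>v\<close> there are \<open>2 * a\<close> potential arcs, so bigness
    leaves at most one missing over both directions together.\<close>
  have missing: "card (S - {u. E v u}) + card (S - {u. E u v}) \<le> 1"
    if "v \<in> B" "v \<in> X \<and> S = Y \<or> v \<in> Y \<and> S = X" for v S
  proof (rule card_missing_neighbours)
    show "finite S" "card S = a" using that fin cards by auto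
    show "{u. E v u} \<subseteq> S" "{u. E u v} \<subseteq> S" using that arc XY(2) by blast+
    show "2 * a - 1 \<le> card {u. E v u} + card {u. E u v}"
      using that(1) by (simp add: B_def degree_conv_neighbours E_def)
  qed
  have two: "y = y'" if "y \<in> T" "y' \<in> T" "card T \<le> 1" "finite T" for y y' :: 'a and T
    using that by (metis card_le_Suc0_iff_eq One_nat_def)
  have "near_complete_bipartite E X Y B a"
  proof
    show "y = y'" if "v \<in> B" "v \<in> X \<and> {y, y'} \<subseteq> Y \<or> v \<in> Y \<and> {y, y'} \<subseteq> X" "\<not> E v y" "\<not> E v y'" for v y y'
      using two[of y "Y - {u. E v u}" y'] two[of y "X - {u. E v u}" y'] missing[OF that(1), of X]
        missing[OF that(1), of Y] that fin by force
    show "y = y'" if "v \<in> B" "v \<in> X \<and> {y, y'} \<subseteq> Y \<or> v \<in> Y \<and> {y, y'} \<subseteq> X" "\<not> E y v" "\<not> E y' v" for v y y'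
      using two[of y "Y - {u. E u v}" y'] two[of y "X - {u. E u v}" y'] missing[OF that(1), of X]
        missing[OF that(1), of Y] that fin by force
    show "E y' v" if v: "v \<in> B" "v \<in> X \<and> {y, y'} \<subseteq> Y \<or> v \<in> Y \<and> {y, y'} \<subseteq> X" "\<not> E v y" for v y y'
    proof (rule ccontr)
      assume "\<not> E y' v"
      define S where "S = (if v \<in> X then Y else X)"
      have S: "v \<in> X \<and> S = Y \<or> v \<in> Y \<and> S = X" "y \<in> S" "y' \<in> S" "finite S"
        using v(2) XY(2) fin by (auto simp: S_def)
      then have "S - {u. E v u} \<noteq> {}" "S - {u. E u v} \<noteq> {}" using v(3) \<open>\<not> E y' v\<close> by blast+
      then have "1 \<le> card (S - {u. E v u})" "1 \<le> card (S - {u. E u v})"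
        using S(4) by (simp_all add: Suc_le_eq card_gt_0_iff)
      then show False using missing[OF v(1) S(1)] by simp
    qed
    show "\<exists>u\<in>S. \<exists>v\<in>X \<union> Y - S. E u v" if "S \<subseteq> X \<union> Y" "S \<noteq> {}" "S \<noteq> X \<union> Y" for S
      using strongly_connected_cut[OF assms(2), of S] that XY(1) by (simp add: E_def)
    show "(X \<union> Y) \<inter> B \<noteq> {}"
    proof
      assume "(X \<union> Y) \<inter> B = {}"
      \<comment> \<open>Without big vertices \<open>small\<close> makes in-neighbours unique, which
        forces the excluded directed cycle.\<close>
      then have "u = v" if "E u w" "E v w" for u v w using small[of u v w] arc that by blast
      then have "is_directed_cycle D"
        using is_directed_cycle_if_unique_in_neighbours[OF assms(2)] assms(4,5) by (auto simp: E_def)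
      then show False using assms(6) by contradiction
    qed
    show "4 \<le> a" using assms(5) by simp
  qed (fact fin cards XY(2) arc small)+
  then interpret near_complete_bipartite E X Y B a .
  have E: "E = (\<lambda>u v. u \<rightarrow>\<^bsub>D\<^esub> v)" by (simp add: E_def fun_eq_iff)
  from all_even_cycles_or_D8 show ?thesis
  proof
    assume "\<forall>k. 1 \<le> k \<and> k \<le> a \<longrightarrow> (\<exists>vs. is_cycle E vs \<and> length vs = 2 * k)"
    then show ?thesis using has_cycle_of_length_if_is_cycle unfolding E by metis
  next
    assume "D8_embedding E (X \<union> Y)"
    then show ?thesis using digraph_iso_D8_if_embedding unfolding E XY by simp
  qed
qed

end
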